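(* Let $F$ be a field of characteristic $0$ and let $p$ be an odd prime. For every finite group $G$ there exist a finite abelian $p$-group $P$ and a rational S-ring $S \subseteq FP$ over $P$ such that $\operatorname{Aut}(S) \cong G$ (as groups).
   Context: Let $P$ be a finite group and $F$ a field. For $C \subseteq P$ write $\overline{C} = \sum_{g\in C} g \in FP$, and for $C\subseteq P$ let $C^{(-1)} = \{g^{-1} : g \in C\}$. An S-ring (Schur ring) over $P$ is a subalgebra $S$ of the group algebra $FP$ for which there are disjoint nonempty subsets $T_1,\dots,T_n$ of $P$ such that $\overline{T_1},\dots,\overline{T_n}$ form a basis of $S$, (i) for every $i$ there is $j$ with $T_i^{(-1)} = T_j$, and (ii) $T_1 = \{1\}$ and $P = T_1\cup\cdots\cup T_n$. The $T_i$ are called the basic sets of $S$ and the $\overline{T_i}$ its basic quantities. The S-ring $S$ is rational if $\phi(x) = x$ for every $x \in S$ and every $\phi \in \operatorname{Aut}(P)$ (with $\phi$ extended linearly to $FP$). An isomorphism of S-rings is an $F$-algebra isomorphism mapping basic quantities to basic quantities; an automorphism of $S$ is an S-ring isomorphism from $S$ onto itself, and $\operatorname{Aut}(S)$ denotes the group of all automorphisms of $S$. *)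

theory Defs
  imports
    "HOL-Algebra.Algebra"
    "HOL-Library.Function_Algebras"
    "HOL-Library.Disjoint_Sets"
    "HOL-Library.Indicator_Function"
begin

text \<open>
  An element \<open>\<Sum>g\<in>P. x\<^sub>g g\<close> of the group algebra \<open>FP\<close> is represented by its coefficient
  function \<open>x\<close>, which is required to vanish outside \<open>carrier P\<close>.  The sum of a subset \<open>C\<close> of \<open>P\<close>
  in \<open>FP\<close> is therefore the function \<open>indicator C\<close>.  The pointwise multiplication that
  \<open>Function_Algebras\<close> puts on functions is never used.
\<close>

abbreviation coeff_scale :: "'f::field \<Rightarrow> ('a \<Rightarrow> 'f) \<Rightarrow> 'a \<Rightarrow> 'f" where
  "coeff_scale c x \<equiv> (\<lambda>g. c * x g)"

interpretation coeff: vector_space "coeff_scale :: 'f::field \<Rightarrow> ('a \<Rightarrow> 'f) \<Rightarrow> 'a \<Rightarrow> 'f"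
  by unfold_locales (auto simp: fun_eq_iff algebra_simps)

definition group_algebra :: "('a, 'm) monoid_scheme \<Rightarrow> ('a \<Rightarrow> 'f::field) ring" where
  "group_algebra P =
    \<lparr>carrier = {x. \<forall>g. g \<notin> carrier P \<longrightarrow> x g = 0},
     monoid.mult = (\<lambda>x y k. \<Sum>(g, h) | g \<in> carrier P \<and> h \<in> carrier P \<and> g \<otimes>\<^bsub>P\<^esub> h = k. x g * y h),
     monoid.one = indicator {\<one>\<^bsub>P\<^esub>},
     ring.zero = 0,
     ring.add = (+)\<rparr>"

definition is_subalgebra :: "('a, 'm) monoid_scheme \<Rightarrow> ('a \<Rightarrow> 'f::field) set \<Rightarrow> bool" where
  "is_subalgebra P S \<longleftrightarrow> subring S (group_algebra P) \<and> coeff.subspace S"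

text \<open>
  \<open>S_ring_partition P S \<T>\<close> says that \<open>\<T>\<close> is a family \<open>{T\<^sub>1, \<dots>, T\<^sub>n}\<close> witnessing that the
  subalgebra \<open>S\<close> is an S-ring over \<open>P\<close>; \<open>partition_on\<close> comprises that the members are nonempty,
  pairwise disjoint and cover \<open>P\<close>.
\<close>

definition S_ring_partition ::
    "('a, 'm) monoid_scheme \<Rightarrow> ('a \<Rightarrow> 'f::field) set \<Rightarrow> 'a set set \<Rightarrow> bool" where
  "S_ring_partition P S \<T> \<longleftrightarrow>
     partition_on (carrier P) \<T> \<and> {\<one>\<^bsub>P\<^esub>} \<in> \<T> \<and>
     (\<forall>T\<in>\<T>. m_inv P ` T \<in> \<T>) \<and>
     coeff.independent (indicator ` \<T> :: ('a \<Rightarrow> 'f) set) \<and>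
     coeff.span (indicator ` \<T>) = S"

definition S_ring :: "('a, 'm) monoid_scheme \<Rightarrow> ('a \<Rightarrow> 'f::field) set \<Rightarrow> bool" where
  "S_ring P S \<longleftrightarrow> is_subalgebra P S \<and> (\<exists>\<T>. S_ring_partition P S \<T>)"

text \<open>The family of basic sets is determined by \<open>S\<close>, so the description below is proper.\<close>

definition basic_sets :: "('a, 'm) monoid_scheme \<Rightarrow> ('a \<Rightarrow> 'f::field) set \<Rightarrow> 'a set set" where
  "basic_sets P S = (THE \<T>. S_ring_partition P S \<T>)"

lemma span_indicator_constant:
  fixes x :: "'a \<Rightarrow> 'f::field"
  assumes "disjoint \<T>" "T \<in> \<T>" "g \<in> T" "h \<in> T" "x \<in> coeff.span (indicator ` \<T>)"
  shows "x g = x h"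
proof -
  have "coeff.subspace {y :: 'a \<Rightarrow> 'f. y g = y h}"
    by (auto simp: coeff.subspace_def)
  moreover have "y g = y h" if y: "y \<in> indicator ` \<T>" for y :: "'a \<Rightarrow> 'f"
  proof -
    obtain T' where T': "T' \<in> \<T>" "y = indicator T'" using y by blast
    then have "T = T' \<or> T \<inter> T' = {}" using assms by (auto simp: disjoint_def)
    then show ?thesis using T' assms by (auto simp: indicator_def)
  qed
  ultimately show ?thesis
    using assms(5) coeff.span_induct[of x "indicator ` \<T>" "\<lambda>y. y g = y h"] by blast
qed

lemma S_ring_partition_subset:
  fixes S :: "('a \<Rightarrow> 'f::field) set"
  assumes A: "S_ring_partition P S \<A>" and B: "S_ring_partition P S \<B>"
  shows "\<A> \<subseteq> \<B>"
proof
  fix T assume T: "T \<in> \<A>"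
  have refine: "V \<subseteq> W"
    if "S_ring_partition P S \<V>" "S_ring_partition P S \<W>" "V \<in> \<V>" "W \<in> \<W>" "g \<in> V" "g \<in> W"
    for \<V> \<W> V W g
  proof
    fix h assume "h \<in> V"
    have "(indicator W :: 'a \<Rightarrow> 'f) \<in> coeff.span (indicator ` \<W>)"
      using that(4) by (intro coeff.span_base) auto
    then have "(indicator W :: 'a \<Rightarrow> 'f) \<in> coeff.span (indicator ` \<V>)"
      using that(1,2) by (simp add: S_ring_partition_def)
    then have "(indicator W g :: 'f) = indicator W h"
      using that(1,3,5) \<open>h \<in> V\<close>
      by (intro span_indicator_constant) (auto simp: S_ring_partition_def partition_on_def)
    then show "h \<in> W" using that(6) by (auto simp: indicator_def split: if_splits)
  qed
  have "T \<noteq> {}"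
    using A T by (auto simp: S_ring_partition_def partition_on_def)
  then obtain g where g: "g \<in> T" by blast
  have "g \<in> \<Union>\<B>"
    using A B T g by (auto simp: S_ring_partition_def partition_on_def)
  then obtain T' where T': "T' \<in> \<B>" "g \<in> T'" by blast
  have "T = T'" using refine[OF A B T T'(1) g T'(2)] refine[OF B A T'(1) T T'(2) g] by blast
  then show "T \<in> \<B>" using T' by simp
qed

lemma basic_sets_eq: "S_ring_partition P S \<T> \<Longrightarrow> basic_sets P S = \<T>"
  unfolding basic_sets_def
  by (rule the_equality) (auto dest: S_ring_partition_subset)

definition basic_quantities ::
    "('a, 'm) monoid_scheme \<Rightarrow> ('a \<Rightarrow> 'f::field) set \<Rightarrow> ('a \<Rightarrow> 'f) set" where
  "basic_quantities P S = indicator ` basic_sets P S"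

definition linear_extension ::
    "('a, 'm) monoid_scheme \<Rightarrow> ('a \<Rightarrow> 'a) \<Rightarrow> ('a \<Rightarrow> 'f::field) \<Rightarrow> 'a \<Rightarrow> 'f" where
  "linear_extension P \<phi> x = (\<Sum>g\<in>carrier P. coeff_scale (x g) (indicator {\<phi> g}))"

definition rational_S_ring :: "('a, 'm) monoid_scheme \<Rightarrow> ('a \<Rightarrow> 'f::field) set \<Rightarrow> bool" where
  "rational_S_ring P S \<longleftrightarrow>
     S_ring P S \<and> (\<forall>\<phi>\<in>auto P. \<forall>x\<in>S. linear_extension P \<phi> x = x)"

definition S_ring_iso ::
    "('a, 'm) monoid_scheme \<Rightarrow> ('a \<Rightarrow> 'f::field) set \<Rightarrow>
     ('b, 'n) monoid_scheme \<Rightarrow> ('b \<Rightarrow> 'f) set \<Rightarrow> (('a \<Rightarrow> 'f) \<Rightarrow> ('b \<Rightarrow> 'f)) set" where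
  "S_ring_iso P S Q S' =
     {\<Phi> \<in> ring_iso (group_algebra P\<lparr>carrier := S\<rparr>) (group_algebra Q\<lparr>carrier := S'\<rparr>).
        (\<forall>c. \<forall>x\<in>S. \<Phi> (coeff_scale c x) = coeff_scale c (\<Phi> x)) \<and>
        (\<forall>q\<in>basic_quantities P S. \<Phi> q \<in> basic_quantities Q S')}"

text \<open>
  As for \<open>AutoGroup\<close>, the group operation is composition, and automorphisms are taken to be
  \<open>undefined\<close> outside \<open>S\<close>, so that distinct elements of the group differ as maps on \<open>S\<close>.
\<close>

definition S_ring_Aut ::
    "('a, 'm) monoid_scheme \<Rightarrow> ('a \<Rightarrow> 'f::field) set \<Rightarrow> (('a \<Rightarrow> 'f) \<Rightarrow> ('a \<Rightarrow> 'f)) monoid" where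
  "S_ring_Aut P S = BijGroup S\<lparr>carrier := S_ring_iso P S P S \<inter> Bij S\<rparr>"

end

theory Submission imports Defs begin

text \<open>
  Let \<open>P\<close> be the product of cyclic groups of order \<open>p\<^bsup>2i+2\<^esup>\<close>, with distinct \<open>i\<close>.  Assigning to a set \<open>D\<close> of
  indices the subgroup of all \<open>x\<close> such that \<open>x\<^sub>i\<close> is divisible by \<open>p\<^bsup>i\<^esup>\<close> for \<open>i \<in> D\<close> and by \<open>p\<^bsup>i+1\<^esup>\<close> for
  \<open>i \<notin> D\<close> embeds the lattice of all sets of indices into the lattice of characteristic subgroups of \<open>P\<close>,
  and the order of the subgroup depends only on \<open>card D\<close>.  A sublattice of characteristic subgroups that
  contains \<open>1\<close> and \<open>P\<close> spans a rational S-ring, because the indicator functions of two subgroups satisfy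
  \<open>1\<^sub>A 1\<^sub>B = card (A \<inter> B) 1\<^bsub>AB\<^esub>\<close>; here each member \<open>A\<close> of the sublattice contributes one basic set,
  consisting of the elements of \<open>A\<close> that lie in no smaller member.  A lattice automorphism that keeps the
  orders of the subgroups therefore induces an automorphism of the S-ring.  Conversely, as \<open>p\<close> is odd, every
  element of \<open>A\<close> is a product of two elements of the basic set of \<open>A\<close>, so the structure constants determine
  the order relation of the lattice.  For the lattice of down-sets of a finite poset \<open>Y\<close> this yields an S-ring
  with automorphism group \<open>Aut Y\<close>, and every finite group is the automorphism group of a finite poset.
\<close>

section \<open>The group algebra\<close>

lemma sum_fun_apply: "(\<Sum>i\<in>I. f i) x = (\<Sum>i\<in>I. f i x)"
  for f :: "'i \<Rightarrow> 'a \<Rightarrow> 'b::comm_monoid_add"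
  by (induction I rule: infinite_finite_induct) auto

text \<open>In a factorization \<open>k = g h\<close> the factor \<open>h\<close> is determined by
  \<open>g\<close>, so the sum over pairs collapses to a sum over one factor.\<close>

lemma group_algebra_mult_eq:
  assumes "group P" "finite (carrier P)"
  shows "x \<otimes>\<^bsub>group_algebra P\<^esub> y =
    (\<lambda>k. if k \<in> carrier P then \<Sum>g\<in>carrier P. x g * y (inv\<^bsub>P\<^esub> g \<otimes>\<^bsub>P\<^esub> k) else 0)"
proof
  interpret group P by fact
  fix k
  have *: "{(g, h). g \<in> carrier P \<and> h \<in> carrier P \<and> g \<otimes>\<^bsub>P\<^esub> h = k} =
     (if k \<in> carrier P then (\<lambda>g. (g, inv\<^bsub>P\<^esub> g \<otimes>\<^bsub>P\<^esub> k)) ` carrier P else {})"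
    by (auto simp: inv_solve_left' m_assoc[symmetric] image_iff)
  have "(x \<otimes>\<^bsub>group_algebra P\<^esub> y) k =
      (\<Sum>(g, h)\<in>{(g, h). g \<in> carrier P \<and> h \<in> carrier P \<and> g \<otimes>\<^bsub>P\<^esub> h = k}. x g * y h)"
    by (simp add: group_algebra_def)
  also have "\<dots> = (if k \<in> carrier P then \<Sum>g\<in>carrier P. x g * y (inv\<^bsub>P\<^esub> g \<otimes>\<^bsub>P\<^esub> k) else 0)"
    unfolding * by (auto simp: sum.reindex inj_on_def)
  finally show "(x \<otimes>\<^bsub>group_algebra P\<^esub> y) k =
      (if k \<in> carrier P then \<Sum>g\<in>carrier P. x g * y (inv\<^bsub>P\<^esub> g \<otimes>\<^bsub>P\<^esub> k) else 0)" .
qed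

lemma group_algebra_simps [simp]:
  "carrier (group_algebra P) = {x. \<forall>g. g \<notin> carrier P \<longrightarrow> x g = 0}"
  "\<one>\<^bsub>group_algebra P\<^esub> = indicator {\<one>\<^bsub>P\<^esub>}"
  "\<zero>\<^bsub>group_algebra P\<^esub> = 0"
  "x \<oplus>\<^bsub>group_algebra P\<^esub> y = x + y"
  by (simp_all add: group_algebra_def)

lemma abelian_group_group_algebra: "abelian_group (group_algebra P)"
proof (rule abelian_groupI)
  fix x assume "x \<in> carrier (group_algebra P)"
  then show "\<exists>y\<in>carrier (group_algebra P). y \<oplus>\<^bsub>group_algebra P\<^esub> x = \<zero>\<^bsub>group_algebra P\<^esub>"
    by (intro bexI[of _ "- x"]) auto
qed (auto simp: algebra_simps)

lemma group_algebra_mult_bilinear: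
  assumes "group P" "finite (carrier P)"
  shows "(x + x') \<otimes>\<^bsub>group_algebra P\<^esub> y = x \<otimes>\<^bsub>group_algebra P\<^esub> y + x' \<otimes>\<^bsub>group_algebra P\<^esub> y"
    and "y \<otimes>\<^bsub>group_algebra P\<^esub> (x + x') = y \<otimes>\<^bsub>group_algebra P\<^esub> x + y \<otimes>\<^bsub>group_algebra P\<^esub> x'"
    and "coeff_scale c x \<otimes>\<^bsub>group_algebra P\<^esub> y = coeff_scale c (x \<otimes>\<^bsub>group_algebra P\<^esub> y)"
    and "y \<otimes>\<^bsub>group_algebra P\<^esub> coeff_scale c x = coeff_scale c (y \<otimes>\<^bsub>group_algebra P\<^esub> x)"
    and "0 \<otimes>\<^bsub>group_algebra P\<^esub> y = 0"
    and "y \<otimes>\<^bsub>group_algebra P\<^esub> 0 = 0"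
  unfolding group_algebra_mult_eq[OF assms]
  by (simp_all add: fun_eq_iff distrib_left distrib_right sum.distrib sum_distrib_left mult.assoc mult.left_commute[of _ c])

text \<open>The coefficient at \<open>k\<close> counts the factorizations of \<open>k\<close> into
  an element of \<open>A\<close> and one of \<open>B\<close>. Any two of them differ by an element
  of \<open>A \<inter> B\<close>, so the count is the same for all \<open>k\<close> in
  \<open>A <#> B\<close>, even if that set is not a subgroup.\<close>

lemma (in group) group_algebra_mult_indicator_subgroups:
  assumes fin: "finite (carrier G)" and A: "subgroup A G" and B: "subgroup B G"
  shows "(indicator A \<otimes>\<^bsub>group_algebra G\<^esub> indicator B :: 'a \<Rightarrow> 'f::field) =
    coeff_scale (of_nat (card (A \<inter> B))) (indicator (A <#> B))"
proof
  fix k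
  interpret A: subgroup A G by fact
  interpret B: subgroup B G by fact
  show "(indicator A \<otimes>\<^bsub>group_algebra G\<^esub> indicator B :: 'a \<Rightarrow> 'f) k =
    of_nat (card (A \<inter> B)) * indicator (A <#> B) k"
  proof (cases "k \<in> carrier G")
    case False
    then have "k \<notin> A <#> B" by (auto simp: set_mult_def)
    with False show ?thesis by (simp add: group_algebra_mult_eq[OF is_group fin])
  next
    case True
    let ?M = "{g \<in> A. inv g \<otimes> k \<in> B}"
    have "(indicator A \<otimes>\<^bsub>group_algebra G\<^esub> indicator B :: 'a \<Rightarrow> 'f) k =
        (\<Sum>g\<in>carrier G. if g \<in> ?M then 1 else 0)"
      using True unfolding group_algebra_mult_eq[OF is_group fin]
      by (auto intro!: sum.cong simp: indicator_def)
    also have "\<dots> = of_nat (card (carrier G \<inter> ?M))"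
      using fin by (subst sum.inter_restrict[symmetric]) auto
    also have "carrier G \<inter> ?M = ?M" by auto
    finally have eq: "(indicator A \<otimes>\<^bsub>group_algebra G\<^esub> indicator B :: 'a \<Rightarrow> 'f) k = of_nat (card ?M)" .
    show ?thesis
    proof (cases "k \<in> A <#> B")
      case False
      have "?M = {}"
      proof (rule ccontr)
        assume "?M \<noteq> {}"
        then obtain g where g: "g \<in> A" "inv g \<otimes> k \<in> B" by blast
        then have "k = g \<otimes> (inv g \<otimes> k)" using True by (simp add: m_assoc[symmetric])
        with g have "k \<in> A <#> B" unfolding set_mult_def by blast
        with False show False by simp
      qed
      with eq False show ?thesis by simp
    next
      case k: True
      then obtain a b where ab: "a \<in> A" "b \<in> B" "k = a \<otimes> b" by (auto simp: set_mult_def)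
      \<comment> \<open>\<open>?M\<close> records factorizations by their left factor. One
        factorization \<open>k = a b\<close> yields all others as \<open>(a t) (inv t b)\<close>
        with \<open>t\<close> in \<open>A \<inter> B\<close>.\<close>
      have "bij_betw (\<lambda>t. a \<otimes> t) (A \<inter> B) ?M"
      proof (rule bij_betwI[where g = "\<lambda>g. inv a \<otimes> g"])
        show "(\<lambda>t. a \<otimes> t) \<in> A \<inter> B \<rightarrow> ?M"
          using ab by (auto simp: inv_mult_group m_assoc inv_solve_left)
           (metis A.mem_carrier B.m_closed B.m_inv_closed B.mem_carrier l_inv l_one m_assoc m_closed inv_closed)
        show "(\<lambda>g. inv a \<otimes> g) \<in> ?M \<rightarrow> A \<inter> B"
        proof
          fix g assume "g \<in> ?M"
          then have g: "g \<in> A" "inv g \<otimes> (a \<otimes> b) \<in> B" using ab by auto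
          then have "b \<otimes> inv (inv g \<otimes> (a \<otimes> b)) \<in> B" using ab by blast
          also have "b \<otimes> inv (inv g \<otimes> (a \<otimes> b)) = inv a \<otimes> g"
            using ab g by (simp add: inv_mult_group m_assoc[symmetric])
          finally show "inv a \<otimes> g \<in> A \<inter> B" using ab g by auto
        qed
        show "inv a \<otimes> (a \<otimes> t) = t" if "t \<in> A \<inter> B" for t
          using that ab by (simp add: m_assoc[symmetric])
        show "a \<otimes> (inv a \<otimes> g) = g" if "g \<in> ?M" for g
          using that ab by (simp add: m_assoc[symmetric])
      qed
      from bij_betw_same_card[OF this] have "card ?M = card (A \<inter> B)" by simp
      with eq k show ?thesis by simp
    qed
  qed
qed

text \<open>Evaluation at a point of a member \<open>T\<close> annihilates the indicators of all
  other members but not that of \<open>T\<close>.\<close>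

lemma independent_disjoint_indicators:
  assumes "disjoint \<T>" "{} \<notin> \<T>"
  shows "coeff.independent (indicator ` \<T> :: ('a \<Rightarrow> 'f::field) set)"
proof
  assume "coeff.dependent (indicator ` \<T> :: ('a \<Rightarrow> 'f) set)"
  then obtain T where T: "T \<in> \<T>"
    "(indicator T :: 'a \<Rightarrow> 'f) \<in> coeff.span (indicator ` \<T> - {indicator T})"
    unfolding coeff.dependent_def by blast
  obtain g where g: "g \<in> T" using T(1) assms(2) by fastforce
  have "coeff.subspace {x :: 'a \<Rightarrow> 'f. x g = 0}" by (auto simp: coeff.subspace_def)
  moreover have "indicator ` \<T> - {indicator T} \<subseteq> {x :: 'a \<Rightarrow> 'f. x g = 0}"
    using assms(1) T(1) g by (fastforce simp: disjoint_def indicator_def)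
  ultimately have "(indicator T :: 'a \<Rightarrow> 'f) \<in> {x. x g = 0}"
    using T(2) coeff.span_minimal by blast
  with g show False by simp
qed

section \<open>S-rings of lattices of characteristic subgroups\<close>

text \<open>
  Here \<open>J\<close> indexes a lattice of subgroups, and \<open>lev g\<close> is the index of the smallest member that contains \<open>g\<close>.
\<close>

locale graded_group = comm_group P for P (structure) +
  fixes J :: "'i set set" and lev :: "'a \<Rightarrow> 'i set"
  assumes finite_P: "finite (carrier P)"
    and J_Int: "A \<in> J \<Longrightarrow> B \<in> J \<Longrightarrow> A \<inter> B \<in> J"
    and J_Un: "A \<in> J \<Longrightarrow> B \<in> J \<Longrightarrow> A \<union> B \<in> J"
    and lev_in_J: "g \<in> carrier P \<Longrightarrow> lev g \<in> J"
    and lev_eq_empty: "g \<in> carrier P \<Longrightarrow> lev g = {} \<longleftrightarrow> g = \<one>"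
    and lev_mult: "g \<in> carrier P \<Longrightarrow> h \<in> carrier P \<Longrightarrow> lev (g \<otimes> h) \<subseteq> lev g \<union> lev h"
    and lev_inv: "g \<in> carrier P \<Longrightarrow> lev (inv g) = lev g"
    and lev_split: "g \<in> carrier P \<Longrightarrow> A \<in> J \<Longrightarrow> B \<in> J \<Longrightarrow> lev g \<subseteq> A \<union> B \<Longrightarrow>
      \<exists>a\<in>carrier P. \<exists>b\<in>carrier P. lev a \<subseteq> A \<and> lev b \<subseteq> B \<and> g = a \<otimes> b"
    and lev_generic: "g \<in> carrier P \<Longrightarrow> D \<in> J \<Longrightarrow> lev g \<subseteq> D \<Longrightarrow>
      \<exists>a\<in>carrier P. \<exists>b\<in>carrier P. lev a = D \<and> lev b = D \<and> g = a \<otimes> b"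
    and lev_auto: "\<phi> \<in> auto P \<Longrightarrow> g \<in> carrier P \<Longrightarrow> lev (\<phi> g) = lev g"
begin

section \<open>The rational S-ring of functions constant on layers\<close>

definition layer :: "'i set \<Rightarrow> 'a set" where
  "layer D = {g \<in> carrier P. lev g = D}"

definition sub :: "'i set \<Rightarrow> 'a set" where
  "sub D = {g \<in> carrier P. lev g \<subseteq> D}"

text \<open>This form makes membership a pointwise check; \<open>span_layers\<close> and
  \<open>span_subs\<close> identify it with the span of the layers and with that of the
  subgroups.\<close>

definition lev_ring :: "('a \<Rightarrow> 'f::field) set" where
  "lev_ring = {x. (\<forall>g. g \<notin> carrier P \<longrightarrow> x g = 0) \<and>
     (\<forall>g\<in>carrier P. \<forall>h\<in>carrier P. lev g = lev h \<longrightarrow> x g = x h)}"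

text \<open>The values of an element of \<open>lev_ring\<close> at the points \<open>rep D\<close>
  are its coordinates with respect to the layers.\<close>

definition rep :: "'i set \<Rightarrow> 'a" where
  "rep D = (SOME g. g \<in> layer D)"

lemma empty_in_J: "{} \<in> J"
  using lev_in_J[of \<one>] lev_eq_empty[of \<one>] by simp

text \<open>The identity has empty level, so \<open>lev_generic\<close> writes it as a product of
  two elements of level exactly \<open>D\<close>.\<close>

lemma layer_nonempty: "D \<in> J \<Longrightarrow> layer D \<noteq> {}"
  using lev_generic[of \<one> D] lev_eq_empty[of \<one>] by (auto simp: layer_def)

lemma rep [simp]: "D \<in> J \<Longrightarrow> rep D \<in> carrier P" "D \<in> J \<Longrightarrow> lev (rep D) = D"
  using layer_nonempty[of D] someI_ex[of "\<lambda>g. g \<in> layer D"] unfolding rep_def layer_def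
  by auto

lemma finite_J: "finite J"
proof -
  have "J \<subseteq> lev ` carrier P" by (metis rep image_eqI subsetI)
  then show ?thesis using finite_P finite_subset by blast
qed

lemma subgroup_sub: "subgroup (sub D) P"
proof (rule subgroupI)
  show "sub D \<noteq> {}" using lev_eq_empty[of \<one>] by (auto simp: sub_def)
next
  show "a \<otimes> b \<in> sub D" if "a \<in> sub D" "b \<in> sub D" for a b
    using that lev_mult[of a b] by (auto simp: sub_def)
qed (auto simp: sub_def lev_inv)

lemma sub_Int: "sub A \<inter> sub B = sub (A \<inter> B)"
  by (auto simp: sub_def)

lemma sub_mult: "A \<in> J \<Longrightarrow> B \<in> J \<Longrightarrow> sub A <#> sub B = sub (A \<union> B)"
proof
  show "sub A <#> sub B \<subseteq> sub (A \<union> B)"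
    using lev_mult by (fastforce simp: sub_def set_mult_def)
  show "sub (A \<union> B) \<subseteq> sub A <#> sub B" if "A \<in> J" "B \<in> J"
    using lev_split[OF _ that] by (fastforce simp: sub_def set_mult_def)
qed

lemma layer_empty: "layer {} = {\<one>}"
  using lev_eq_empty by (auto simp: layer_def)

text \<open>Together with \<open>span_subs\<close> this is the complete multiplication table of
  \<open>lev_ring\<close>: meets enter through the scalar, joins through the subgroup.\<close>

lemma mult_indicator_sub:
  assumes "A \<in> J" "B \<in> J"
  shows "(indicator (sub A) \<otimes>\<^bsub>group_algebra P\<^esub> indicator (sub B) :: 'a \<Rightarrow> 'f::field) =
    coeff_scale (of_nat (card (sub (A \<inter> B)))) (indicator (sub (A \<union> B)))"
  by (simp add: group_algebra_mult_indicator_subgroups[OF finite_P subgroup_sub subgroup_sub]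
      sub_Int sub_mult assms)

lemma lev_ring_eqD:
    "x \<in> lev_ring \<Longrightarrow> g \<in> carrier P \<Longrightarrow> h \<in> carrier P \<Longrightarrow> lev g = lev h \<Longrightarrow> x g = x h"
  and lev_ring_zeroD: "x \<in> lev_ring \<Longrightarrow> g \<notin> carrier P \<Longrightarrow> x g = 0"
  unfolding lev_ring_def by blast+

lemma lev_ringI:
  "(\<And>g. g \<notin> carrier P \<Longrightarrow> x g = 0) \<Longrightarrow>
    (\<And>g h. g \<in> carrier P \<Longrightarrow> h \<in> carrier P \<Longrightarrow> lev g = lev h \<Longrightarrow> x g = x h) \<Longrightarrow> x \<in> lev_ring"
  unfolding lev_ring_def by blast

lemma lev_ring_rep: "x \<in> lev_ring \<Longrightarrow> g \<in> carrier P \<Longrightarrow> x (rep (lev g)) = x g"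
  by (rule lev_ring_eqD) (auto simp: lev_in_J)

lemma subspace_lev_ring: "coeff.subspace (lev_ring :: ('a \<Rightarrow> 'f::field) set)"
proof (rule coeff.subspaceI)
  fix x y :: "'a \<Rightarrow> 'f" and c
  assume x: "x \<in> lev_ring"
  show "coeff_scale c x \<in> lev_ring"
  proof (rule lev_ringI)
    show "c * x g = c * x h" if "g \<in> carrier P" "h \<in> carrier P" "lev g = lev h" for g h
      by (simp only: lev_ring_eqD[OF x that])
  qed (simp add: lev_ring_zeroD[OF x])
  assume y: "y \<in> lev_ring"
  show "x + y \<in> lev_ring"
  proof (rule lev_ringI)
    show "(x + y) g = (x + y) h" if "g \<in> carrier P" "h \<in> carrier P" "lev g = lev h" for g h
      by (simp only: plus_fun_apply lev_ring_eqD[OF x that] lev_ring_eqD[OF y that])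
  qed (simp add: lev_ring_zeroD[OF x] lev_ring_zeroD[OF y])
qed (simp add: lev_ring_def)

lemma indicator_layer_in: "indicator (layer D) \<in> lev_ring"
  and indicator_sub_in: "indicator (sub D) \<in> lev_ring"
  by (auto intro!: lev_ringI simp: layer_def sub_def indicator_def)

lemma lev_ring_expand:
  assumes "(x :: 'a \<Rightarrow> 'f::field) \<in> lev_ring"
  shows "x = (\<Sum>D\<in>J. coeff_scale (x (rep D)) (indicator (layer D)))"
proof
  fix g
  note [simp] = sum_fun_apply
  show "x g = (\<Sum>D\<in>J. coeff_scale (x (rep D)) (indicator (layer D))) g"
  proof (cases "g \<in> carrier P")
    case True
    have "(\<Sum>D\<in>J. x (rep D) * indicator (layer D) g) = (\<Sum>D\<in>J. if D = lev g then x g else 0)"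
      using True by (intro sum.cong) (auto simp: layer_def indicator_def lev_ring_rep[OF assms])
    with True show ?thesis by (simp add: finite_J lev_in_J)
  next
    case False
    then show ?thesis by (simp add: lev_ring_zeroD[OF assms] layer_def)
  qed
qed

lemma span_layers: "coeff.span (indicator ` layer ` J) = (lev_ring :: ('a \<Rightarrow> 'f::field) set)"
proof (rule coeff.span_subspace)
  show "lev_ring \<subseteq> coeff.span (indicator ` layer ` J :: ('a \<Rightarrow> 'f) set)"
  proof
    fix x :: "'a \<Rightarrow> 'f" assume "x \<in> lev_ring"
    have "(\<Sum>D\<in>J. coeff_scale (x (rep D)) (indicator (layer D))) \<in> coeff.span (indicator ` layer ` J)"
      by (intro coeff.span_sum coeff.span_scale coeff.span_base) auto
    then show "x \<in> coeff.span (indicator ` layer ` J)"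
      using lev_ring_expand[OF \<open>x \<in> lev_ring\<close>] by simp
  qed
qed (auto simp: indicator_layer_in subspace_lev_ring)

text \<open>Each \<open>sub D\<close> is the disjoint union of the layers of the members below
  \<open>D\<close>, so layers are recovered from subgroups by Moebius inversion. It is carried out
  by induction on the number of members properly below \<open>D\<close>.\<close>

lemma span_subs: "coeff.span (indicator ` sub ` J) = (lev_ring :: ('a \<Rightarrow> 'f::field) set)"
proof (rule coeff.span_subspace)
  have fin: "finite {E \<in> J. E \<subset> D}" for D using finite_J by simp
  have layer: "(indicator (layer D) :: 'a \<Rightarrow> 'f) \<in> coeff.span (indicator ` sub ` J)" if "D \<in> J" for D
    using that
  proof (induction "card {E \<in> J. E \<subset> D}" arbitrary: D rule: less_induct)
    case less
    have "(\<Sum>E | E \<in> J \<and> E \<subset> D. indicator (layer E)) =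
        (indicator (sub D) - indicator (layer D) :: 'a \<Rightarrow> 'f)"
    proof
      fix g
      note [simp] = sum_fun_apply
      show "(\<Sum>E | E \<in> J \<and> E \<subset> D. indicator (layer E)) g =
          (indicator (sub D) - indicator (layer D) :: 'a \<Rightarrow> 'f) g"
      proof (cases "g \<in> carrier P")
        case True
        have "(\<Sum>E | E \<in> J \<and> E \<subset> D. indicator (layer E) g :: 'f) =
            (\<Sum>E | E \<in> J \<and> E \<subset> D. if E = lev g then 1 else 0)"
          using True by (intro sum.cong) (auto simp: layer_def indicator_def)
        with True show ?thesis
          by (auto simp: fin lev_in_J layer_def sub_def indicator_def)
      qed (simp add: layer_def sub_def)
    qed
    then have eq: "(indicator (layer D) :: 'a \<Rightarrow> 'f) =
        indicator (sub D) - (\<Sum>E | E \<in> J \<and> E \<subset> D. indicator (layer E))"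
      by simp
    have "card {E' \<in> J. E' \<subset> E} < card {E \<in> J. E \<subset> D}" if "E \<in> J" "E \<subset> D" for E
      using that by (intro psubset_card_mono fin) auto
    then have "indicator (layer E) \<in> coeff.span (indicator ` sub ` J :: ('a \<Rightarrow> 'f) set)"
      if "E \<in> {E \<in> J. E \<subset> D}" for E
      using less that by blast
    with less.prems show ?case
      unfolding eq by (intro coeff.span_diff coeff.span_sum) (auto intro: coeff.span_base)
  qed
  then show "lev_ring \<subseteq> coeff.span (indicator ` sub ` J :: ('a \<Rightarrow> 'f) set)"
    by (subst span_layers[symmetric]) (rule coeff.span_minimal; auto)
qed (auto simp: indicator_sub_in subspace_lev_ring)

text \<open>By bilinearity, closure need only be checked on indicators of subgroups, first in the
  left factor and then in the right one.\<close>

lemma lev_ring_mult_closed: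
  fixes x y :: "'a \<Rightarrow> 'f::field"
  assumes "x \<in> lev_ring" "y \<in> lev_ring"
  shows "x \<otimes>\<^bsub>group_algebra P\<^esub> y \<in> lev_ring"
proof -
  note bil = group_algebra_mult_bilinear[OF is_group finite_P]
  note sp = coeff.subspace_0[OF subspace_lev_ring] coeff.subspace_add[OF subspace_lev_ring]
    coeff.subspace_scale[OF subspace_lev_ring]
  have 1: "x \<otimes>\<^bsub>group_algebra P\<^esub> indicator (sub B) \<in> lev_ring" if "B \<in> J" for B
    using assms(1)[folded span_subs]
  proof (induction rule: coeff.span_induct_alt)
    case (step c z w)
    then obtain A where "A \<in> J" "z = indicator (sub A)" by blast
    with step that show ?case
      unfolding bil by (intro sp) (auto simp: mult_indicator_sub intro!: sp indicator_sub_in)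
  qed (simp only: bil sp)
  show ?thesis
    using assms(2)[folded span_subs]
  proof (induction rule: coeff.span_induct_alt)
    case (step c z w)
    then obtain B where "B \<in> J" "z = indicator (sub B)" by blast
    with step show ?case unfolding bil by (intro sp) (auto intro!: sp 1)
  qed (simp only: bil sp)
qed

lemma S_ring_partition_lev_ring:
  "S_ring_partition P (lev_ring :: ('a \<Rightarrow> 'f::field) set) (layer ` J)"
proof -
  have part: "partition_on (carrier P) (layer ` J)"
    using layer_nonempty lev_in_J
    by (auto simp: partition_on_def disjoint_def layer_def)
  have "m_inv P ` layer D = layer D" for D
  proof
    show "m_inv P ` layer D \<subseteq> layer D" by (auto simp: layer_def lev_inv)
    \<comment> \<open>Inversion is an involution, so the inclusion just shown yields the reverse
      one.\<close>
    then have "m_inv P ` m_inv P ` layer D \<subseteq> m_inv P ` layer D" by blast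
    then show "layer D \<subseteq> m_inv P ` layer D" by (force simp: layer_def image_iff)
  qed
  moreover have "coeff.independent (indicator ` layer ` J :: ('a \<Rightarrow> 'f) set)"
    using part by (intro independent_disjoint_indicators) (auto simp: partition_on_def)
  moreover have "{\<one>} \<in> layer ` J" using layer_empty empty_in_J by blast
  ultimately show ?thesis
    using part by (simp add: S_ring_partition_def span_layers)
qed

lemma is_subalgebra_lev_ring: "is_subalgebra P (lev_ring :: ('a \<Rightarrow> 'f::field) set)"
proof -
  let ?A = "group_algebra P :: ('a \<Rightarrow> 'f) ring"
  interpret A: abelian_group ?A by (rule abelian_group_group_algebra)
  have a_inv: "\<ominus>\<^bsub>?A\<^esub> x = - x" if "x \<in> lev_ring" for x
    using that by (intro A.minus_equality) (auto simp: lev_ring_zeroD)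
  have "subgroup (lev_ring :: ('a \<Rightarrow> 'f) set) (add_monoid ?A)"
  proof (rule group.subgroupI[OF A.a_group])
    show "inv\<^bsub>add_monoid ?A\<^esub> x \<in> lev_ring" if "x \<in> lev_ring" for x
      using a_inv[OF that] coeff.subspace_neg[OF subspace_lev_ring that]
      by (simp add: a_inv_def)
  qed (use indicator_sub_in in \<open>auto simp: lev_ring_zeroD coeff.subspace_add[OF subspace_lev_ring]\<close>)
  moreover have "submonoid (lev_ring :: ('a \<Rightarrow> 'f) set) ?A"
    using indicator_layer_in[of "{}"]
    by unfold_locales (auto simp: lev_ring_zeroD lev_ring_mult_closed layer_empty)
  ultimately show ?thesis
    by (simp add: is_subalgebra_def subring_def subspace_lev_ring)
qed

text \<open>An automorphism permutes \<open>carrier P\<close> and preserves levels, so its linear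
  extension only rearranges equal coefficients.\<close>

lemma rational_lev_ring: "rational_S_ring P (lev_ring :: ('a \<Rightarrow> 'f::field) set)"
proof -
  have "linear_extension P \<phi> x = x"
    if \<phi>: "\<phi> \<in> auto P" and x: "x \<in> lev_ring" for \<phi> and x :: "'a \<Rightarrow> 'f"
  proof
    fix k
    have bij: "bij_betw \<phi> (carrier P) (carrier P)" using \<phi> by (simp add: auto_def Bij_def)
    note [simp] = sum_fun_apply
    have "linear_extension P \<phi> x k = (\<Sum>g\<in>carrier P. x (\<phi> g) * indicator {\<phi> g} k)"
    proof -
      have "x (\<phi> g) = x g" if "g \<in> carrier P" for g
        using that bij_betwE[OF bij] by (intro lev_ring_eqD[OF x]) (auto simp: lev_auto[OF \<phi>])
      then show ?thesis by (simp add: linear_extension_def)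
    qed
    also have "\<dots> = (\<Sum>g\<in>carrier P. x g * indicator {g} k)"
      using sum.reindex_bij_betw[OF bij, of "\<lambda>g. x g * indicator {g} k"] by simp
    also have "\<dots> = (\<Sum>g\<in>carrier P. if g = k then x k else 0)"
      by (intro sum.cong) auto
    also have "\<dots> = x k" using x by (simp add: finite_P lev_ring_zeroD)
    finally show "linear_extension P \<phi> x k = x k" .
  qed
  then show ?thesis
    using S_ring_partition_lev_ring is_subalgebra_lev_ring
    by (auto simp: rational_S_ring_def S_ring_def)
qed

section \<open>The action of lattice automorphisms on the S-ring\<close>

definition level_Aut :: "('i set \<Rightarrow> 'i set) monoid" where
  "level_Aut = BijGroup J\<lparr>carrier := {\<tau> \<in> Bij J.
     (\<forall>A\<in>J. \<forall>B\<in>J. \<tau> A \<subseteq> \<tau> B \<longleftrightarrow> A \<subseteq> B) \<and> (\<forall>A\<in>J. card (sub (\<tau> A)) = card (sub A))}\<rparr>"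

text \<open>Push-forward of coefficients: the value on the layer of \<open>D\<close> moves to the
  layer of \<open>\<tau> D\<close>, whence the inverse of \<open>\<tau>\<close>. The restriction
  matches the convention that automorphisms are \<open>undefined\<close> outside the S-ring.\<close>

definition transport :: "('i set \<Rightarrow> 'i set) \<Rightarrow> ('a \<Rightarrow> 'f::field) \<Rightarrow> 'a \<Rightarrow> 'f" where
  "transport \<tau> = (\<lambda>x\<in>lev_ring. \<lambda>g. if g \<in> carrier P then x (rep (inv_into J \<tau> (lev g))) else 0)"

text \<open>The test points have the form \<open>rep (\<tau> D)\<close> because
  \<open>transport_rep\<close> evaluates transported functions there; surjectivity of
  \<open>\<tau>\<close> reaches every layer.\<close>

lemma lev_ring_eqI:
  assumes x: "x \<in> lev_ring" and y: "y \<in> lev_ring" and \<tau>: "bij_betw \<tau> J J"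
    and eq: "\<And>D. D \<in> J \<Longrightarrow> x (rep (\<tau> D)) = y (rep (\<tau> D))"
  shows "x = y"
proof
  fix g
  show "x g = y g"
  proof (cases "g \<in> carrier P")
    case True
    obtain D where D: "D \<in> J" "\<tau> D = lev g"
      using \<tau> lev_in_J[OF True] by (metis bij_betw_iff_bijections)
    show ?thesis using eq[OF D(1)] by (simp add: D(2) lev_ring_rep x y True)
  qed (simp add: lev_ring_zeroD x y)
qed

lemma indicator_layer_rep: "D \<in> J \<Longrightarrow> indicator (layer E) (rep D) = (if D = E then 1 else 0)"
  and indicator_sub_rep: "D \<in> J \<Longrightarrow> indicator (sub E) (rep D) = (if D \<subseteq> E then 1 else 0)"
  by (auto simp: layer_def sub_def indicator_def)

lemma J_imageI: "bij_betw \<tau> J J \<Longrightarrow> D \<in> J \<Longrightarrow> \<tau> D \<in> J"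
  by (auto simp: bij_betw_def)

lemma transport_rep:
  assumes "bij_betw \<tau> J J" "x \<in> lev_ring" "D \<in> J"
  shows "transport \<tau> x (rep (\<tau> D)) = x (rep D)"
  using assms by (simp add: transport_def J_imageI bij_betw_inv_into_left)

lemma transport_in:
  assumes "x \<in> lev_ring"
  shows "transport \<tau> x \<in> lev_ring"
proof (rule lev_ringI)
  show "transport \<tau> x g = transport \<tau> x h"
    if "g \<in> carrier P" "h \<in> carrier P" "lev g = lev h" for g h
    using that by (simp add: transport_def assms)
qed (simp add: transport_def assms)

lemma transport_layer:
  assumes \<tau>: "bij_betw \<tau> J J" and D: "D \<in> J"
  shows "transport \<tau> (indicator (layer D)) = indicator (layer (\<tau> D))"
proof (rule lev_ring_eqI[OF _ _ \<tau>])
  fix E assume "E \<in> J"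
  moreover from \<tau> this D have "\<tau> E = \<tau> D \<longleftrightarrow> E = D"
    by (auto simp: bij_betw_def inj_on_def)
  ultimately show "transport \<tau> (indicator (layer D)) (rep (\<tau> E)) = indicator (layer (\<tau> D)) (rep (\<tau> E))"
    by (simp add: transport_rep[OF \<tau>] indicator_layer_in indicator_layer_rep J_imageI[OF \<tau>])
qed (simp_all add: transport_in indicator_layer_in)

lemma transport_add:
  assumes "x \<in> lev_ring" "y \<in> lev_ring"
  shows "transport \<tau> (x + y) = transport \<tau> x + transport \<tau> y"
  using assms coeff.subspace_add[OF subspace_lev_ring assms]
  by (auto simp: transport_def fun_eq_iff)

lemma transport_scale:
  assumes "x \<in> lev_ring"
  shows "transport \<tau> (coeff_scale c x) = coeff_scale c (transport \<tau> x)"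
  using assms coeff.subspace_scale[OF subspace_lev_ring assms]
  by (auto simp: transport_def fun_eq_iff)

lemma transport_zero: "transport \<tau> 0 = 0"
  using coeff.subspace_0[OF subspace_lev_ring] by (auto simp: transport_def fun_eq_iff)

lemma transport_compose:
  assumes \<tau>: "bij_betw \<tau> J J" and \<sigma>: "bij_betw \<sigma> J J" and x: "x \<in> lev_ring"
  shows "transport (compose J \<tau> \<sigma>) x = transport \<tau> (transport \<sigma> x)"
proof -
  have b: "bij_betw (compose J \<tau> \<sigma>) J J" using bij_betw_compose[OF \<sigma> \<tau>] .
  show ?thesis
  proof (rule lev_ring_eqI[OF _ _ b])
    fix D assume D: "D \<in> J"
    show "transport (compose J \<tau> \<sigma>) x (rep (compose J \<tau> \<sigma> D)) =
        transport \<tau> (transport \<sigma> x) (rep (compose J \<tau> \<sigma> D))"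
      unfolding transport_rep[OF b x D] using D
      by (simp add: compose_eq transport_rep \<tau> \<sigma> x transport_in J_imageI[OF \<sigma>])
  qed (simp_all add: transport_in x)
qed

lemma transport_id:
  assumes x: "x \<in> lev_ring"
  shows "transport (\<lambda>D\<in>J. D) x = x"
proof -
  have b: "bij_betw (\<lambda>D\<in>J. D) J J" using id_Bij by (auto simp: Bij_def)
  show ?thesis
  proof (rule lev_ring_eqI[OF _ _ b])
    fix D assume D: "D \<in> J"
    show "transport (\<lambda>D\<in>J. D) x (rep ((\<lambda>D\<in>J. D) D)) = x (rep ((\<lambda>D\<in>J. D) D))"
      unfolding transport_rep[OF b x D] using D by simp
  qed (simp_all add: transport_in x)
qed

text \<open>By \<open>transport_compose\<close> and \<open>transport_id\<close>, transport along the
  inverse permutation inverts transport along \<open>\<tau>\<close>.\<close>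

lemma transport_Bij:
  assumes \<tau>: "\<tau> \<in> Bij J"
  shows "transport \<tau> \<in> Bij (lev_ring :: ('a \<Rightarrow> 'f::field) set)"
proof -
  let ?\<sigma> = "restrict (inv_into J \<tau>) J"
  have b: "bij_betw \<tau> J J" using \<tau> by (simp add: Bij_def)
  have \<sigma>: "?\<sigma> \<in> Bij J" using restrict_inv_into_Bij[OF \<tau>] by simp
  then have b': "bij_betw ?\<sigma> J J" by (simp add: Bij_def)
  have 1: "compose J ?\<sigma> \<tau> = (\<lambda>D\<in>J. D)" using Bij_compose_restrict_eq[OF \<tau>] .
  have 2: "compose J \<tau> ?\<sigma> = (\<lambda>D\<in>J. D)"
    using b by (auto simp: compose_def fun_eq_iff bij_betw_inv_into_right)
  have "bij_betw (transport \<tau>) (lev_ring :: ('a \<Rightarrow> 'f) set) lev_ring"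
  proof (rule bij_betwI)
    fix x :: "'a \<Rightarrow> 'f" assume x: "x \<in> lev_ring"
    show "transport ?\<sigma> (transport \<tau> x) = x"
      using transport_compose[OF b' b x] transport_id[OF x] by (simp only: 1)
    show "transport \<tau> (transport ?\<sigma> x) = x"
      using transport_compose[OF b b' x] transport_id[OF x] by (simp only: 2)
  qed (simp_all add: transport_in)
  then show ?thesis by (simp add: Bij_def transport_def)
qed

lemma level_AutD:
  assumes "\<tau> \<in> carrier level_Aut"
  shows "\<tau> \<in> Bij J" "bij_betw \<tau> J J"
    and "A \<in> J \<Longrightarrow> B \<in> J \<Longrightarrow> \<tau> A \<subseteq> \<tau> B \<longleftrightarrow> A \<subseteq> B"
    and "A \<in> J \<Longrightarrow> card (sub (\<tau> A)) = card (sub A)"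
  using assms by (auto simp: level_Aut_def Bij_def)

text \<open>Within \<open>J\<close> the intersection is the greatest lower bound, so order
  automorphisms preserve it. One inclusion is monotonicity; the other pulls the intersection of the
  images back to some \<open>C\<close>.\<close>

lemma level_Aut_Int:
  assumes \<tau>: "\<tau> \<in> carrier level_Aut" and AB: "A \<in> J" "B \<in> J"
  shows "\<tau> (A \<inter> B) = \<tau> A \<inter> \<tau> B"
proof
  note J = J_imageI[OF level_AutD(2)[OF \<tau>]]
  show "\<tau> (A \<inter> B) \<subseteq> \<tau> A \<inter> \<tau> B"
    using AB by (simp add: level_AutD(3)[OF \<tau>] J_Int)
  obtain C where C: "C \<in> J" "\<tau> C = \<tau> A \<inter> \<tau> B"
    using level_AutD(2)[OF \<tau>] J_Int[OF J[OF AB(1)] J[OF AB(2)]]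
    by (metis bij_betw_iff_bijections)
  then have "C \<subseteq> A" "C \<subseteq> B"
    using AB level_AutD(3)[OF \<tau> C(1)] by blast+
  then show "\<tau> A \<inter> \<tau> B \<subseteq> \<tau> (A \<inter> B)"
    using C AB level_AutD(3)[OF \<tau> C(1) J_Int[OF AB]] by auto
qed

lemma level_Aut_Un:
  assumes \<tau>: "\<tau> \<in> carrier level_Aut" and AB: "A \<in> J" "B \<in> J"
  shows "\<tau> (A \<union> B) = \<tau> A \<union> \<tau> B"
proof
  note J = J_imageI[OF level_AutD(2)[OF \<tau>]]
  show "\<tau> A \<union> \<tau> B \<subseteq> \<tau> (A \<union> B)"
    using AB by (simp add: level_AutD(3)[OF \<tau>] J_Un)
  obtain C where C: "C \<in> J" "\<tau> C = \<tau> A \<union> \<tau> B"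
    using level_AutD(2)[OF \<tau>] J_Un[OF J[OF AB(1)] J[OF AB(2)]]
    by (metis bij_betw_iff_bijections)
  then have "A \<subseteq> C" "B \<subseteq> C"
    using AB level_AutD(3)[OF \<tau> _ C(1)] by blast+
  then show "\<tau> (A \<union> B) \<subseteq> \<tau> A \<union> \<tau> B"
    using C AB level_AutD(3)[OF \<tau> J_Un[OF AB] C(1)] by auto
qed

lemma transport_sub:
  assumes \<tau>: "\<tau> \<in> carrier level_Aut" and D: "D \<in> J"
  shows "transport \<tau> (indicator (sub D)) = indicator (sub (\<tau> D))"
proof (rule lev_ring_eqI[OF _ _ level_AutD(2)[OF \<tau>]])
  note b = level_AutD(2)[OF \<tau>]
  fix E assume "E \<in> J"
  with D show "transport \<tau> (indicator (sub D)) (rep (\<tau> E)) = indicator (sub (\<tau> D)) (rep (\<tau> E))"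
    by (simp add: transport_rep[OF b] indicator_sub_in indicator_sub_rep J_imageI[OF b] level_AutD(3)[OF \<tau>])
qed (simp_all add: transport_in indicator_sub_in)

text \<open>On indicators of subgroups this compares multiplication tables: unions and intersections
  are preserved because the order is, and the scalar because \<open>level_Aut\<close> preserves the
  orders of the subgroups. Bilinearity does the rest.\<close>

lemma transport_mult:
  fixes x y :: "'a \<Rightarrow> 'f::field"
  assumes \<tau>: "\<tau> \<in> carrier level_Aut" and x: "x \<in> lev_ring" and y: "y \<in> lev_ring"
  shows "transport \<tau> (x \<otimes>\<^bsub>group_algebra P\<^esub> y) =
    transport \<tau> x \<otimes>\<^bsub>group_algebra P\<^esub> transport \<tau> y"
proof -
  let ?m = "\<lambda>x y :: 'a \<Rightarrow> 'f. x \<otimes>\<^bsub>group_algebra P\<^esub> y"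
  note bil = group_algebra_mult_bilinear[OF is_group finite_P]
  note J = J_imageI[OF level_AutD(2)[OF \<tau>]]
  note sp = coeff.subspace_add[OF subspace_lev_ring] coeff.subspace_scale[OF subspace_lev_ring]
    lev_ring_mult_closed indicator_sub_in
  note tr = transport_add transport_scale transport_zero transport_sub[OF \<tau>] sp
  \<comment> \<open>Membership is carried through the induction because \<open>transport_add\<close>
    and \<open>transport_scale\<close> apply only inside \<open>lev_ring\<close>.\<close>
  have 1: "x \<in> lev_ring \<and> transport \<tau> (?m x (indicator (sub B))) = ?m (transport \<tau> x) (transport \<tau> (indicator (sub B)))"
    if B: "B \<in> J" for B
    using x[folded span_subs]
  proof (induction rule: coeff.span_induct_alt)
    case base
    show ?case by (simp only: bil transport_zero coeff.subspace_0[OF subspace_lev_ring])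
  next
    case (step c z w)
    then obtain A where A: "A \<in> J" "z = indicator (sub A)" by blast
    have "transport \<tau> (?m z (indicator (sub B))) = ?m (transport \<tau> z) (transport \<tau> (indicator (sub B)))"
      using A B level_AutD(4)[OF \<tau> J_Int[OF A(1) B]]
      by (simp add: tr mult_indicator_sub J J_Un level_Aut_Int[OF \<tau>] level_Aut_Un[OF \<tau>])
    with step A show ?case by (simp only: bil tr)
  qed
  have "y \<in> lev_ring \<and> transport \<tau> (?m x y) = ?m (transport \<tau> x) (transport \<tau> y)"
    using y[folded span_subs]
  proof (induction rule: coeff.span_induct_alt)
    case base
    show ?case by (simp only: bil transport_zero coeff.subspace_0[OF subspace_lev_ring])
  next
    case (step c z w)
    then obtain B where B: "B \<in> J" "z = indicator (sub B)" by blast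
    have "transport \<tau> (?m x z) = ?m (transport \<tau> x) (transport \<tau> z)"
      using 1[OF B(1)] B(2) by simp
    with step B x show ?case by (simp only: bil tr)
  qed
  then show ?thesis by blast
qed

section \<open>The automorphism group of the S-ring\<close>

lemma basic_quantities_lev_ring:
  "basic_quantities P (lev_ring :: ('a \<Rightarrow> 'f::field) set) = indicator ` layer ` J"
  by (simp add: basic_quantities_def basic_sets_eq[OF S_ring_partition_lev_ring])

lemma carrier_S_ring_Aut_lev_ring:
  "carrier (S_ring_Aut P (lev_ring :: ('a \<Rightarrow> 'f::field) set)) = {\<Phi> \<in> Bij lev_ring.
    (\<forall>x\<in>lev_ring. \<forall>y\<in>lev_ring. \<Phi> (x \<otimes>\<^bsub>group_algebra P\<^esub> y) = \<Phi> x \<otimes>\<^bsub>group_algebra P\<^esub> \<Phi> y) \<and>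
    (\<forall>x\<in>lev_ring. \<forall>y\<in>lev_ring. \<Phi> (x + y) = \<Phi> x + \<Phi> y) \<and>
    \<Phi> (indicator {\<one>}) = indicator {\<one>} \<and>
    (\<forall>c. \<forall>x\<in>lev_ring. \<Phi> (coeff_scale c x) = coeff_scale c (\<Phi> x)) \<and>
    (\<forall>D\<in>J. \<exists>E\<in>J. \<Phi> (indicator (layer D)) = indicator (layer E))}"
  by (auto simp: S_ring_Aut_def S_ring_iso_def basic_quantities_lev_ring ring_iso_def ring_hom_def
      Bij_def bij_betwE image_iff)

lemma transport_in_S_ring_Aut:
  assumes \<tau>: "\<tau> \<in> carrier level_Aut"
  shows "transport \<tau> \<in> carrier (S_ring_Aut P (lev_ring :: ('a \<Rightarrow> 'f::field) set))"
proof -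
  note b = level_AutD(2)[OF \<tau>]
  \<comment> \<open>The empty set is the least member of \<open>J\<close>, so its preimage lies
    below it and \<open>\<tau>\<close> fixes it. Hence the unit of the group algebra is
    fixed.\<close>
  obtain D where D: "D \<in> J" "\<tau> D = {}"
    using b empty_in_J by (metis bij_betw_iff_bijections)
  then have "D = {}" using level_AutD(3)[OF \<tau> D(1) empty_in_J] by blast
  with D have \<tau>0: "\<tau> {} = {}" by simp
  have "transport \<tau> (indicator {\<one>}) = (indicator {\<one>} :: 'a \<Rightarrow> 'f)"
    using transport_layer[OF b empty_in_J] by (simp add: \<tau>0 layer_empty)
  then show ?thesis
    unfolding carrier_S_ring_Aut_lev_ring
    using transport_Bij[OF level_AutD(1)[OF \<tau>]] transport_layer[OF b] J_imageI[OF b]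
    by (auto simp: transport_mult[OF \<tau>] transport_add transport_scale)
qed

text \<open>The coefficient counts the ways to write \<open>rep A\<close> as a product of two
  elements of \<open>layer B\<close>, and in characteristic 0 it vanishes only if there are none.
  This expresses the order of \<open>J\<close> by structure constants.\<close>

lemma square_layer_nonzero_iff:
  assumes "A \<in> J" "B \<in> J"
  shows "(indicator (layer B) \<otimes>\<^bsub>group_algebra P\<^esub> indicator (layer B) :: 'a \<Rightarrow> 'f::field_char_0) (rep A) \<noteq> 0
    \<longleftrightarrow> A \<subseteq> B"
proof -
  let ?M = "{g \<in> layer B. inv g \<otimes> rep A \<in> layer B}"
  have "(indicator (layer B) \<otimes>\<^bsub>group_algebra P\<^esub> indicator (layer B) :: 'a \<Rightarrow> 'f) (rep A) =
      (\<Sum>g\<in>carrier P. if g \<in> ?M then 1 else 0)"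
    using assms unfolding group_algebra_mult_eq[OF is_group finite_P]
    by (auto intro!: sum.cong simp: indicator_def)
  also have "\<dots> = of_nat (card (carrier P \<inter> ?M))"
    using finite_P by (subst sum.inter_restrict[symmetric]) auto
  also have "carrier P \<inter> ?M = ?M" by (auto simp: layer_def)
  finally have eq: "(indicator (layer B) \<otimes>\<^bsub>group_algebra P\<^esub> indicator (layer B) :: 'a \<Rightarrow> 'f) (rep A) \<noteq> 0
      \<longleftrightarrow> ?M \<noteq> {}"
    using finite_P by (auto simp: layer_def)
  show ?thesis
  proof
    assume "(indicator (layer B) \<otimes>\<^bsub>group_algebra P\<^esub> indicator (layer B) :: 'a \<Rightarrow> 'f) (rep A) \<noteq> 0"
    then obtain g where g: "g \<in> carrier P" "lev g = B" "lev (inv g \<otimes> rep A) = B"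
      using eq by (auto simp: layer_def)
    moreover have "rep A = g \<otimes> (inv g \<otimes> rep A)"
      using g assms by (simp add: m_assoc[symmetric])
    ultimately have "lev (rep A) \<subseteq> B"
      using lev_mult[of g "inv g \<otimes> rep A"] assms by auto
    then show "A \<subseteq> B" using assms by simp
  next
    assume "A \<subseteq> B"
    then obtain a b where ab: "a \<in> carrier P" "b \<in> carrier P" "lev a = B" "lev b = B" "rep A = a \<otimes> b"
      using lev_generic[of "rep A" B] assms by auto
    then have "a \<in> ?M" by (simp add: layer_def m_assoc[symmetric])
    then show "(indicator (layer B) \<otimes>\<^bsub>group_algebra P\<^esub> indicator (layer B) :: 'a \<Rightarrow> 'f) (rep A) \<noteq> 0"
      unfolding eq by blast
  qed
qed

text \<open>The permutation of the basic quantities induced by \<open>\<Phi>\<close> is the required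
  \<open>\<tau>\<close>. Squares of layers show that it preserves the order; then
  \<open>\<Phi>\<close> permutes the indicators of the subgroups, whose squares reveal their
  orders.\<close>

lemma S_ring_Aut_is_transport:
  assumes \<Phi>: "\<Phi> \<in> carrier (S_ring_Aut P (lev_ring :: ('a \<Rightarrow> 'f::field_char_0) set))"
  shows "\<Phi> \<in> transport ` carrier level_Aut"
proof -
  have bij: "\<Phi> \<in> Bij lev_ring"
    and mult: "\<And>x y. x \<in> lev_ring \<Longrightarrow> y \<in> lev_ring \<Longrightarrow>
      \<Phi> (x \<otimes>\<^bsub>group_algebra P\<^esub> y) = \<Phi> x \<otimes>\<^bsub>group_algebra P\<^esub> \<Phi> y"
    and add: "\<And>x y. x \<in> lev_ring \<Longrightarrow> y \<in> lev_ring \<Longrightarrow> \<Phi> (x + y) = \<Phi> x + \<Phi> y"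
    and scale: "\<And>c x. x \<in> lev_ring \<Longrightarrow> \<Phi> (coeff_scale c x) = coeff_scale c (\<Phi> x)"
    and basic: "\<forall>D\<in>J. \<exists>E\<in>J. \<Phi> (indicator (layer D)) = indicator (layer E)"
    using \<Phi> unfolding carrier_S_ring_Aut_lev_ring by auto
  obtain \<tau>' where \<tau>': "\<And>D. D \<in> J \<Longrightarrow> \<tau>' D \<in> J \<and> \<Phi> (indicator (layer D)) = indicator (layer (\<tau>' D))"
    using basic by metis
  define \<tau> where "\<tau> = restrict \<tau>' J"
  have \<tau>: "\<tau> D \<in> J" "\<Phi> (indicator (layer D)) = indicator (layer (\<tau> D))" if "D \<in> J" for D
    using \<tau>'[OF that] that by (auto simp: \<tau>_def)
  have "inj_on \<tau> J"
  proof (rule inj_onI)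
    fix D E assume DE: "D \<in> J" "E \<in> J" "\<tau> D = \<tau> E"
    then have "\<Phi> (indicator (layer D)) = \<Phi> (indicator (layer E))" by (simp add: \<tau>)
    then have "(indicator (layer D) :: 'a \<Rightarrow> 'f) = indicator (layer E)"
      using bij indicator_layer_in by (auto simp: Bij_def bij_betw_def inj_on_def)
    from fun_cong[OF this, of "rep D"] show "D = E"
      using DE by (simp add: indicator_layer_rep split: if_splits)
  qed
  then have b: "bij_betw \<tau> J J"
    using \<tau>(1) finite_J by (simp add: bij_betw_def endo_inj_surj image_subsetI)
  then have Bij: "\<tau> \<in> Bij J" by (simp add: Bij_def \<tau>_def)
  have eq: "\<Phi> x = transport \<tau> x" if "x \<in> lev_ring" for x
  proof -
    have "x \<in> lev_ring \<and> \<Phi> x = transport \<tau> x"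
      using that[folded span_layers]
    proof (induction rule: coeff.span_induct_alt)
      case base
      have "\<Phi> (coeff_scale 0 (indicator (layer {}))) = 0"
        unfolding scale[OF indicator_layer_in] by (simp add: fun_eq_iff)
      then show ?case
        by (simp add: transport_zero coeff.subspace_0[OF subspace_lev_ring] zero_fun_def[symmetric])
    next
      case (step c z w)
      then obtain D where D: "D \<in> J" "z = indicator (layer D)" by blast
      note sp = coeff.subspace_add[OF subspace_lev_ring] coeff.subspace_scale[OF subspace_lev_ring]
      have z: "z \<in> lev_ring" "\<Phi> z = transport \<tau> z"
        using D by (simp_all add: indicator_layer_in \<tau> transport_layer[OF b])
      with step show ?case by (simp only: sp add scale transport_add transport_scale)
    qed
    then show ?thesis by blast
  qed
  have order: "\<tau> A \<subseteq> \<tau> B \<longleftrightarrow> A \<subseteq> B" if "A \<in> J" "B \<in> J" for A B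
  proof -
    let ?q = "\<lambda>D. indicator (layer D) \<otimes>\<^bsub>group_algebra P\<^esub> indicator (layer D) :: 'a \<Rightarrow> 'f"
    have q: "?q B \<in> lev_ring" by (intro lev_ring_mult_closed indicator_layer_in)
    \<comment> \<open>\<open>\<Phi>\<close> carries the square of \<open>layer B\<close> to that of
      \<open>layer (\<tau> B)\<close>, so the two coefficients to be compared agree.\<close>
    have "?q (\<tau> B) (rep (\<tau> A)) = \<Phi> (?q B) (rep (\<tau> A))"
      using that by (simp add: mult indicator_layer_in \<tau>)
    also have "\<dots> = ?q B (rep A)"
      by (simp add: eq[OF q] transport_rep[OF b q that(1)])
    finally show ?thesis
      using square_layer_nonzero_iff[of "\<tau> A" "\<tau> B", where 'f = 'f]
        square_layer_nonzero_iff[of A B, where 'f = 'f] that by (simp add: \<tau>)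
  qed
  have card: "card (sub (\<tau> A)) = card (sub A)" if A: "A \<in> J" for A
  proof -
    have ind: "\<Phi> (indicator (sub A)) = indicator (sub (\<tau> A))"
    proof (rule lev_ring_eqI[OF _ _ b])
      fix E assume "E \<in> J"
      with A show "\<Phi> (indicator (sub A)) (rep (\<tau> E)) = indicator (sub (\<tau> A)) (rep (\<tau> E))"
        by (simp add: eq indicator_sub_in transport_rep[OF b] indicator_sub_rep \<tau> order)
    qed (simp_all add: eq indicator_sub_in transport_in)
    \<comment> \<open>The square of a subgroup indicator is the indicator times the order of the
      subgroup. Evaluating at \<open>rep (\<tau> A)\<close> compares the orders as elements of the
      field, which suffices in characteristic 0.\<close>
    have "coeff_scale (of_nat (card (sub (\<tau> A)))) (indicator (sub (\<tau> A)) :: 'a \<Rightarrow> 'f) =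
        \<Phi> (indicator (sub A) \<otimes>\<^bsub>group_algebra P\<^esub> indicator (sub A))"
      unfolding mult[OF indicator_sub_in indicator_sub_in] ind
      using A by (simp add: mult_indicator_sub \<tau>)
    also have "\<dots> = coeff_scale (of_nat (card (sub A))) (indicator (sub (\<tau> A)))"
      using A by (simp add: mult_indicator_sub scale indicator_sub_in ind)
    finally have "of_nat (card (sub (\<tau> A))) * (indicator (sub (\<tau> A)) (rep (\<tau> A)) :: 'f) =
        of_nat (card (sub A)) * indicator (sub (\<tau> A)) (rep (\<tau> A))"
      by (rule fun_cong)
    then show ?thesis using A by (simp add: indicator_sub_rep \<tau>)
  qed
  have "\<tau> \<in> carrier level_Aut"
    using Bij order card by (simp add: level_Aut_def)
  moreover have "\<Phi> = transport \<tau>"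
  proof
    fix x
    show "\<Phi> x = transport \<tau> x"
      using eq bij by (cases "x \<in> lev_ring") (auto simp: Bij_def transport_def extensional_def)
  qed
  ultimately show ?thesis by blast
qed

theorem level_Aut_iso_S_ring_Aut:
  "level_Aut \<cong> S_ring_Aut P (lev_ring :: ('a \<Rightarrow> 'f::field_char_0) set)"
proof (rule is_isoI, rule isoI)
  let ?A = "S_ring_Aut P (lev_ring :: ('a \<Rightarrow> 'f) set)"
  show "transport \<in> hom level_Aut ?A"
  proof (rule homI)
    fix \<tau> \<sigma> assume \<tau>: "\<tau> \<in> carrier level_Aut" and \<sigma>: "\<sigma> \<in> carrier level_Aut"
    have "transport (compose J \<tau> \<sigma>) = compose lev_ring (transport \<tau>) (transport \<sigma> :: _ \<Rightarrow> 'a \<Rightarrow> 'f)"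
    proof
      fix x :: "'a \<Rightarrow> 'f"
      show "transport (compose J \<tau> \<sigma>) x = compose lev_ring (transport \<tau>) (transport \<sigma>) x"
      proof (cases "x \<in> lev_ring")
        case True
        then show ?thesis
          by (simp add: compose_eq transport_compose[OF level_AutD(2)[OF \<tau>] level_AutD(2)[OF \<sigma>]])
      qed (simp add: transport_def compose_def)
    qed
    then show "transport (\<tau> \<otimes>\<^bsub>level_Aut\<^esub> \<sigma>) = transport \<tau> \<otimes>\<^bsub>?A\<^esub> transport \<sigma>"
      using level_AutD(1)[OF \<tau>] level_AutD(1)[OF \<sigma>]
      by (simp add: level_Aut_def S_ring_Aut_def BijGroup_def transport_Bij)
  qed (rule transport_in_S_ring_Aut)
  have "inj_on (transport :: _ \<Rightarrow> _ \<Rightarrow> 'a \<Rightarrow> 'f) (carrier level_Aut)"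
  proof (rule inj_onI)
    fix \<tau> \<sigma> assume \<tau>: "\<tau> \<in> carrier level_Aut" and \<sigma>: "\<sigma> \<in> carrier level_Aut"
      and eq: "transport \<tau> = (transport \<sigma> :: _ \<Rightarrow> 'a \<Rightarrow> 'f)"
    show "\<tau> = \<sigma>"
    proof (rule extensionalityI)
      show "\<tau> \<in> extensional J" "\<sigma> \<in> extensional J"
        using level_AutD(1)[OF \<tau>] level_AutD(1)[OF \<sigma>] by (simp_all add: Bij_def)
      fix D assume D: "D \<in> J"
      note J = J_imageI[OF level_AutD(2)[OF \<tau>] D] J_imageI[OF level_AutD(2)[OF \<sigma>] D]
      have "(indicator (layer (\<tau> D)) :: 'a \<Rightarrow> 'f) = indicator (layer (\<sigma> D))"
        using transport_layer[OF level_AutD(2)[OF \<tau>] D] transport_layer[OF level_AutD(2)[OF \<sigma>] D] eq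
        by metis
      from fun_cong[OF this, of "rep (\<tau> D)"] show "\<tau> D = \<sigma> D"
        using J by (simp add: indicator_layer_rep split: if_splits)
    qed
  qed
  then show "bij_betw transport (carrier level_Aut) (carrier ?A)"
    using transport_in_S_ring_Aut S_ring_Aut_is_transport by (auto simp: bij_betw_def)
qed

end

section \<open>Automorphisms of a poset and of its lattice of down-sets\<close>

definition order_Aut :: "'y set \<Rightarrow> ('y \<Rightarrow> 'y \<Rightarrow> bool) \<Rightarrow> ('y \<Rightarrow> 'y) monoid" where
  "order_Aut Y R = BijGroup Y\<lparr>carrier := {f \<in> Bij Y. \<forall>x\<in>Y. \<forall>y\<in>Y. R (f x) (f y) \<longleftrightarrow> R x y}\<rparr>"

definition downsets :: "'y set \<Rightarrow> ('y \<Rightarrow> 'y \<Rightarrow> bool) \<Rightarrow> 'y set set" where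
  "downsets Y R = {D. D \<subseteq> Y \<and> (\<forall>x\<in>D. \<forall>y\<in>Y. R y x \<longrightarrow> y \<in> D)}"

locale finite_poset =
  fixes Y :: "'y set" and R :: "'y \<Rightarrow> 'y \<Rightarrow> bool"
  assumes finite_Y: "finite Y"
    and le_refl: "x \<in> Y \<Longrightarrow> R x x"
    and le_trans: "x \<in> Y \<Longrightarrow> y \<in> Y \<Longrightarrow> z \<in> Y \<Longrightarrow> R x y \<Longrightarrow> R y z \<Longrightarrow> R x z"
    and le_antisym: "x \<in> Y \<Longrightarrow> y \<in> Y \<Longrightarrow> R x y \<Longrightarrow> R y x \<Longrightarrow> x = y"
begin

definition down :: "'y \<Rightarrow> 'y set" where
  "down x = {y \<in> Y. R y x}"

lemma down_in: "x \<in> Y \<Longrightarrow> down x \<in> downsets Y R"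
  unfolding downsets_def down_def using le_trans by blast

lemma down_subset_iff: "x \<in> Y \<Longrightarrow> D \<in> downsets Y R \<Longrightarrow> down x \<subseteq> D \<longleftrightarrow> x \<in> D"
  unfolding downsets_def down_def using le_refl by blast

lemma down_le_iff: "x \<in> Y \<Longrightarrow> y \<in> Y \<Longrightarrow> down x \<subseteq> down y \<longleftrightarrow> R x y"
  using down_subset_iff[OF _ down_in] by (simp add: down_def)

lemma down_inj: "x \<in> Y \<Longrightarrow> y \<in> Y \<Longrightarrow> down x = down y \<Longrightarrow> x = y"
  using down_le_iff[of x y] down_le_iff[of y x] le_antisym[of x y] by simp

text \<open>Principal down-sets are the join-irreducible elements of the lattice of down-sets.\<close>

lemma principal_iff:
  assumes D: "D \<in> downsets Y R"
  shows "D \<in> down ` Y \<longleftrightarrow>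
    (\<exists>M\<in>downsets Y R. M \<subset> D \<and> (\<forall>K\<in>downsets Y R. K \<subset> D \<longrightarrow> K \<subseteq> M))"
proof
  assume "D \<in> down ` Y"
  then obtain x where x: "x \<in> Y" "D = down x" by blast
  \<comment> \<open>Removing the greatest element of \<open>down x\<close> leaves the largest
    down-set properly contained in it.\<close>
  have "D - {x} \<in> downsets Y R"
    using x le_antisym D unfolding downsets_def down_def by blast
  moreover have "x \<in> D" using x le_refl by (simp add: down_def)
  moreover have "K \<subseteq> D - {x}" if "K \<in> downsets Y R" "K \<subset> D" for K
    using that x down_subset_iff[of x K] by blast
  ultimately show "\<exists>M\<in>downsets Y R. M \<subset> D \<and> (\<forall>K\<in>downsets Y R. K \<subset> D \<longrightarrow> K \<subseteq> M)"
    by (intro bexI[of _ "D - {x}"]) auto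
next
  assume "\<exists>M\<in>downsets Y R. M \<subset> D \<and> (\<forall>K\<in>downsets Y R. K \<subset> D \<longrightarrow> K \<subseteq> M)"
  then obtain M where M: "M \<in> downsets Y R" "M \<subset> D"
    and max: "\<forall>K\<in>downsets Y R. K \<subset> D \<longrightarrow> K \<subseteq> M" by blast
  \<comment> \<open>Any such \<open>x\<close> generates \<open>D\<close>: otherwise
    \<open>down x\<close> would be a proper down-subset of \<open>D\<close> and so lie in
    \<open>M\<close>.\<close>
  obtain x where x: "x \<in> D" "x \<notin> M" using M(2) by blast
  have Y: "x \<in> Y" using x D by (auto simp: downsets_def)
  have "down x \<subseteq> D" "\<not> down x \<subseteq> M"
    using x down_subset_iff[OF Y D] down_subset_iff[OF Y M(1)] by simp_all
  then have "down x = D" using max down_in[OF Y] by blast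
  with Y show "D \<in> down ` Y" by blast
qed

lemma image_downset:
  assumes f: "f \<in> carrier (order_Aut Y R)" and D: "D \<in> downsets Y R"
  shows "f ` D \<in> downsets Y R"
proof -
  have b: "bij_betw f Y Y" and R: "\<And>x y. x \<in> Y \<Longrightarrow> y \<in> Y \<Longrightarrow> R (f x) (f y) \<longleftrightarrow> R x y"
    using f by (auto simp: order_Aut_def Bij_def)
  have "D \<subseteq> Y" using D by (simp add: downsets_def)
  moreover have "y \<in> f ` D" if xy: "x \<in> D" "y \<in> Y" "R y (f x)" for x y
  proof -
    obtain z where "z \<in> Y" "y = f z" using b xy(2) by (auto simp: bij_betw_def)
    with xy D R \<open>D \<subseteq> Y\<close> show ?thesis unfolding downsets_def by blast
  qed
  moreover have "f ` D \<subseteq> Y" using b \<open>D \<subseteq> Y\<close> unfolding bij_betw_def by blast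
  ultimately show ?thesis by (auto simp: downsets_def)
qed

end

section \<open>Birkhoff duality between poset and lattice automorphisms\<close>

context graded_group
begin

text \<open>An automorphism of \<open>Y\<close> acts on down-sets by taking images, and the
  assumption on cardinalities places this action in \<open>level_Aut\<close>. Conversely, a lattice
  automorphism permutes the join-irreducible elements, which form a copy of
  \<open>Y\<close>.\<close>

lemma order_Aut_iso_level_Aut:
  assumes Y: "finite_poset Y R" and J: "J = downsets Y R"
    and card: "\<And>f D. f \<in> carrier (order_Aut Y R) \<Longrightarrow> D \<in> J \<Longrightarrow> card (sub (f ` D)) = card (sub D)"
  shows "order_Aut Y R \<cong> level_Aut"
proof -
  interpret Y: finite_poset Y R by fact
  define \<Theta> where "\<Theta> = (\<lambda>f :: 'i \<Rightarrow> 'i. \<lambda>D\<in>J. f ` D)"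
  have sub_Y: "D \<subseteq> Y" if "D \<in> J" for D using that by (simp add: J downsets_def)
  have autD: "f \<in> Bij Y" "bij_betw f Y Y" "inj_on f Y"
    "\<And>x y. x \<in> Y \<Longrightarrow> y \<in> Y \<Longrightarrow> R (f x) (f y) \<longleftrightarrow> R x y"
    if "f \<in> carrier (order_Aut Y R)" for f
    using that by (auto simp: order_Aut_def Bij_def bij_betw_def)
  have image_J: "f ` D \<in> J" if "f \<in> carrier (order_Aut Y R)" "D \<in> J" for f D
    using Y.image_downset that by (simp add: J)
  have order: "f ` A \<subseteq> f ` B \<longleftrightarrow> A \<subseteq> B"
    if "f \<in> carrier (order_Aut Y R)" "A \<in> J" "B \<in> J" for f A B
    using inj_on_image_mem_iff[OF autD(3)[OF that(1)] _ sub_Y[OF that(3)]] sub_Y[OF that(2)] by blast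
  have \<Theta>_in: "\<Theta> f \<in> carrier level_Aut" if f: "f \<in> carrier (order_Aut Y R)" for f
  proof -
    have "inj_on (\<Theta> f) J"
    proof (rule inj_onI)
      fix A B assume AB: "A \<in> J" "B \<in> J" "\<Theta> f A = \<Theta> f B"
      then show "A = B"
        using order[OF f AB(1,2)] order[OF f AB(2,1)] by (simp add: \<Theta>_def)
    qed
    moreover have "\<Theta> f ` J \<subseteq> J" using image_J[OF f] by (auto simp: \<Theta>_def)
    ultimately have "bij_betw (\<Theta> f) J J"
      using finite_J by (simp add: bij_betw_def endo_inj_surj)
    then show ?thesis
      using order[OF f] card[OF f] by (auto simp: level_Aut_def Bij_def \<Theta>_def)
  qed
  have hom: "\<Theta> \<in> hom (order_Aut Y R) level_Aut"
  proof (rule homI)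
    fix f g assume f: "f \<in> carrier (order_Aut Y R)" and g: "g \<in> carrier (order_Aut Y R)"
    have "\<Theta> (compose Y f g) = compose J (\<Theta> f) (\<Theta> g)"
    proof
      fix D
      have "compose Y f g ` D = f ` g ` D" if "D \<in> J"
        using sub_Y[OF that] by (auto simp: compose_def image_image)
      then show "\<Theta> (compose Y f g) D = compose J (\<Theta> f) (\<Theta> g) D"
        using image_J[OF g] by (simp add: \<Theta>_def compose_def)
    qed
    then show "\<Theta> (f \<otimes>\<^bsub>order_Aut Y R\<^esub> g) = \<Theta> f \<otimes>\<^bsub>level_Aut\<^esub> \<Theta> g"
      using autD(1)[OF f] autD(1)[OF g] level_AutD(1)[OF \<Theta>_in[OF f]] level_AutD(1)[OF \<Theta>_in[OF g]]
      by (simp add: level_Aut_def order_Aut_def BijGroup_def)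
  qed (rule \<Theta>_in)
  have down_image: "f ` Y.down x = Y.down (f x)"
    if f: "f \<in> carrier (order_Aut Y R)" and x: "x \<in> Y" for f x
  proof -
    have "f ` Y = Y" using autD(2)[OF f] by (simp add: bij_betw_def)
    moreover have "{y \<in> f ` Y. R y (f x)} = f ` {z \<in> Y. R (f z) (f x)}" by blast
    ultimately have "Y.down (f x) = f ` {z \<in> Y. R (f z) (f x)}" by (simp only: Y.down_def)
    also have "{z \<in> Y. R (f z) (f x)} = Y.down x"
      using x autD(4)[OF f] by (auto simp: Y.down_def)
    finally show ?thesis ..
  qed
  have inj: "inj_on \<Theta> (carrier (order_Aut Y R))"
  proof (rule inj_onI)
    fix f g assume f: "f \<in> carrier (order_Aut Y R)" and g: "g \<in> carrier (order_Aut Y R)"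
      and eq: "\<Theta> f = \<Theta> g"
    show "f = g"
    proof (rule extensionalityI)
      show "f \<in> extensional Y" "g \<in> extensional Y"
        using autD(1)[OF f] autD(1)[OF g] by (simp_all add: Bij_def)
      fix x assume x: "x \<in> Y"
      then have "Y.down x \<in> J" by (simp add: J Y.down_in)
      then have "Y.down (f x) = Y.down (g x)"
        using fun_cong[OF eq, of "Y.down x"] by (simp add: \<Theta>_def down_image[symmetric] f g x)
      then show "f x = g x"
        using bij_betwE[OF autD(2)[OF f]] bij_betwE[OF autD(2)[OF g]] x by (intro Y.down_inj) auto
    qed
  qed
  have surj: "\<tau> \<in> \<Theta> ` carrier (order_Aut Y R)" if \<tau>: "\<tau> \<in> carrier level_Aut" for \<tau>
  proof -
    note b = level_AutD(2)[OF \<tau>] and order = level_AutD(3)[OF \<tau>]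
    note \<tau>J = J_imageI[OF b]
    have "\<tau> ` J = J" using b by (simp add: bij_betw_def)
    have psub: "\<tau> A \<subset> \<tau> B \<longleftrightarrow> A \<subset> B" if "A \<in> J" "B \<in> J" for A B
      using that order by (auto simp: psubset_eq)
    \<comment> \<open>The criterion \<open>principal_iff\<close> refers only to inclusion in
      \<open>J\<close>; once its variables range over values of \<open>\<tau>\<close>, it is visibly
      invariant.\<close>
    have principal: "\<tau> D \<in> Y.down ` Y \<longleftrightarrow> D \<in> Y.down ` Y" if D: "D \<in> J" for D
    proof -
      have "(\<exists>M\<in>J. M \<subset> \<tau> D \<and> (\<forall>K\<in>J. K \<subset> \<tau> D \<longrightarrow> K \<subseteq> M)) \<longleftrightarrow>
          (\<exists>M\<in>\<tau> ` J. M \<subset> \<tau> D \<and> (\<forall>K\<in>\<tau> ` J. K \<subset> \<tau> D \<longrightarrow> K \<subseteq> M))"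
        by (simp only: \<open>\<tau> ` J = J\<close>)
      also have "\<dots> \<longleftrightarrow> (\<exists>M\<in>J. M \<subset> D \<and> (\<forall>K\<in>J. K \<subset> D \<longrightarrow> K \<subseteq> M))"
        using D by (simp add: psub order)
      finally show ?thesis
        using Y.principal_iff[of D] Y.principal_iff[of "\<tau> D"] D \<tau>J[OF D] by (simp add: J)
    qed
    have downJ: "Y.down x \<in> J" if "x \<in> Y" for x using that by (simp add: J Y.down_in)
    have "\<exists>y\<in>Y. \<tau> (Y.down x) = Y.down y" if "x \<in> Y" for x
      using principal[OF downJ[OF that]] that by blast
    then obtain f' where f': "\<And>x. x \<in> Y \<Longrightarrow> f' x \<in> Y \<and> \<tau> (Y.down x) = Y.down (f' x)"
      by metis
    define f where "f = restrict f' Y"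
    have f: "f x \<in> Y" "\<tau> (Y.down x) = Y.down (f x)" if "x \<in> Y" for x
      using f'[OF that] that by (auto simp: f_def)
    have f_le: "R (f x) (f y) \<longleftrightarrow> R x y" if "x \<in> Y" "y \<in> Y" for x y
      using that order[OF downJ downJ] by (simp add: f Y.down_le_iff)
    have "inj_on f Y"
      using f_le f(1) Y.le_refl Y.le_antisym by (intro inj_onI) metis
    then have "bij_betw f Y Y"
      using f(1) Y.finite_Y by (simp add: bij_betw_def endo_inj_surj image_subsetI)
    then have f_in: "f \<in> carrier (order_Aut Y R)"
      using f_le by (simp add: order_Aut_def Bij_def f_def)
    have "\<tau> = \<Theta> f"
    proof (rule extensionalityI)
      show "\<tau> \<in> extensional J" using level_AutD(1)[OF \<tau>] by (simp add: Bij_def)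
      show "\<Theta> f \<in> extensional J" by (simp add: \<Theta>_def)
      fix D assume D: "D \<in> J"
      \<comment> \<open>Membership of a point is inclusion of its principal down-set, which
        \<open>\<tau>\<close> respects; so \<open>\<tau> D\<close> is the image of \<open>D\<close>
        under \<open>f\<close>.\<close>
      have "f x \<in> \<tau> D \<longleftrightarrow> x \<in> D" if "x \<in> Y" for x
      proof -
        have "f x \<in> \<tau> D \<longleftrightarrow> \<tau> (Y.down x) \<subseteq> \<tau> D"
          using Y.down_subset_iff[of "f x" "\<tau> D"] that \<tau>J[OF D] by (simp add: f J)
        also have "\<dots> \<longleftrightarrow> x \<in> D"
          using order[OF downJ[OF that] D] Y.down_subset_iff[of x D] that D by (simp add: J)
        finally show ?thesis .
      qed
      moreover have "\<tau> D \<subseteq> f ` Y"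
        using \<open>bij_betw f Y Y\<close> sub_Y[OF \<tau>J[OF D]] by (simp add: bij_betw_def)
      ultimately have "\<tau> D = f ` D" using sub_Y[OF D] by blast
      with D show "\<tau> D = \<Theta> f D" by (simp add: \<Theta>_def)
    qed
    with f_in show ?thesis by blast
  qed
  show ?thesis
    using hom inj surj \<Theta>_in by (intro is_isoI isoI) (auto simp: bij_betw_def)
qed

end

section \<open>A finite poset with prescribed automorphism group\<close>

text \<open>
  The chain over \<open>b\<close> records the number \<open>pos (inv a \<otimes> b)\<close>, and hence the element \<open>inv a \<otimes> b\<close>, as the height
  at which it passes above \<open>Src a\<close>.  An automorphism therefore preserves all quotients \<open>inv a \<otimes> b\<close>, which
  makes it a left translation.
\<close>

datatype 'g node = Bot | Src 'g | Chain 'g nat | Top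

text \<open>\<open>Bot\<close> and \<open>Top\<close> provide the least and greatest elements that
  \<open>poset_group\<close> requires. For bijective \<open>pos\<close> the nodes
  \<open>Src a\<close> are the atoms, so an automorphism can recognize them.\<close>

fun node_le :: "('g, 'm) monoid_scheme \<Rightarrow> ('g \<Rightarrow> nat) \<Rightarrow> 'g node \<Rightarrow> 'g node \<Rightarrow> bool" where
  "node_le G pos Bot y \<longleftrightarrow> True"
| "node_le G pos (Src a) y \<longleftrightarrow>
     (case y of Bot \<Rightarrow> False | Src b \<Rightarrow> a = b | Chain b j \<Rightarrow> pos (inv\<^bsub>G\<^esub> a \<otimes>\<^bsub>G\<^esub> b) \<le> j | Top \<Rightarrow> True)"
| "node_le G pos (Chain a i) y \<longleftrightarrow>
     (case y of Chain b j \<Rightarrow> a = b \<and> i \<le> j | Top \<Rightarrow> True | _ \<Rightarrow> False)"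
| "node_le G pos Top y \<longleftrightarrow> y = Top"

definition nodes :: "('g, 'm) monoid_scheme \<Rightarrow> 'g node set" where
  "nodes G = {Bot, Top} \<union> Src ` carrier G \<union> (\<lambda>(a, j). Chain a j) ` (carrier G \<times> {..<card (carrier G)})"

primrec node_act :: "('g, 'm) monoid_scheme \<Rightarrow> 'g \<Rightarrow> 'g node \<Rightarrow> 'g node" where
  "node_act G h Bot = Bot"
| "node_act G h (Src a) = Src (h \<otimes>\<^bsub>G\<^esub> a)"
| "node_act G h (Chain a j) = Chain (h \<otimes>\<^bsub>G\<^esub> a) j"
| "node_act G h Top = Top"

lemma nodes_simps [simp]:
  "Bot \<in> nodes G" "Top \<in> nodes G" "Src a \<in> nodes G \<longleftrightarrow> a \<in> carrier G"
  "Chain a j \<in> nodes G \<longleftrightarrow> a \<in> carrier G \<and> j < card (carrier G)"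
  by (auto simp: nodes_def)

lemma node_le_Bot: "node_le G pos x Bot \<longleftrightarrow> x = Bot"
  by (cases x) auto

lemma node_le_Top: "node_le G pos x Top"
  by (cases x) auto

lemma finite_poset_nodes:
  assumes "finite (carrier G)"
  shows "finite_poset (nodes G) (node_le G pos)"
proof
  show "finite (nodes G)" using assms by (simp add: nodes_def)
  show "node_le G pos x x" for x by (cases x) auto
  show "node_le G pos x z" if "node_le G pos x y" "node_le G pos y z" for x y z
    using that by (cases x; cases y; cases z) auto
  show "x = y" if "node_le G pos x y" "node_le G pos y x" for x y
    using that by (cases x; cases y) auto
qed

context group
begin

text \<open>Left translation keeps the quotients \<open>inv a \<otimes> b\<close> and is faithful
  already on the nodes \<open>Src a\<close>. For surjectivity, an automorphism is shown to permute
  the atoms and to keep heights in the chains; its effect is then read off from the comparisons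
  between the two kinds of nodes.\<close>

lemma iso_order_Aut_nodes:
  assumes fin: "finite (carrier G)" and pos: "bij_betw pos (carrier G) {..<card (carrier G)}"
  shows "G \<cong> order_Aut (nodes G) (node_le G pos)"
proof -
  let ?n = "card (carrier G)" and ?Y = "nodes G" and ?R = "node_le G pos"
  let ?A = "order_Aut ?Y ?R"
  interpret Y: finite_poset ?Y ?R using fin by (rule finite_poset_nodes)
  define \<Theta> where "\<Theta> = (\<lambda>h. restrict (node_act G h) ?Y)"
  have n: "0 < ?n" using fin one_closed card_gt_0_iff by blast
  have pos_less: "pos a < ?n" if "a \<in> carrier G" for a
    using pos that by (auto simp: bij_betw_def)
  have pos_inj: "pos a = pos b \<Longrightarrow> a = b" if "a \<in> carrier G" "b \<in> carrier G" for a b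
    using pos that by (auto simp: bij_betw_def inj_on_def)
  have act_in: "node_act G h x \<in> ?Y" if "h \<in> carrier G" "x \<in> ?Y" for h x
    using that by (cases x) auto
  have act_mult: "node_act G (h \<otimes> k) x = node_act G h (node_act G k x)"
    if "h \<in> carrier G" "k \<in> carrier G" "x \<in> ?Y" for h k x
    using that by (cases x) (auto simp: m_assoc)
  have act_one: "node_act G \<one> x = x" if "x \<in> ?Y" for x
    using that by (cases x) auto
  have act_le: "?R (node_act G h x) (node_act G h y) \<longleftrightarrow> ?R x y"
    if "h \<in> carrier G" "x \<in> ?Y" "y \<in> ?Y" for h x y
  proof -
    have "inv (h \<otimes> a) \<otimes> (h \<otimes> b) = inv a \<otimes> b" if ab: "a \<in> carrier G" "b \<in> carrier G" for a b
    proof -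
      have "inv h \<otimes> (h \<otimes> b) = b" using ab \<open>h \<in> carrier G\<close> by (simp add: m_assoc[symmetric])
      then show ?thesis using ab \<open>h \<in> carrier G\<close> by (simp add: inv_mult_group m_assoc)
    qed
    with that show ?thesis by (cases x; cases y) auto
  qed
  have \<Theta>_in: "\<Theta> h \<in> carrier ?A" if h: "h \<in> carrier G" for h
  proof -
    have "bij_betw (\<Theta> h) ?Y ?Y"
      by (rule bij_betwI[where g = "\<Theta> (inv h)"])
        (use h in \<open>auto simp: \<Theta>_def act_in act_mult[symmetric] act_one\<close>)
    then show ?thesis
      using act_le[OF h] by (simp add: order_Aut_def Bij_def \<Theta>_def)
  qed
  have hom: "\<Theta> \<in> hom G ?A"
  proof (rule homI)
    fix h k assume hk: "h \<in> carrier G" "k \<in> carrier G"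
    then have "\<Theta> (h \<otimes> k) = compose ?Y (\<Theta> h) (\<Theta> k)"
      by (auto simp: \<Theta>_def compose_def act_mult act_in fun_eq_iff)
    then show "\<Theta> (h \<otimes> k) = \<Theta> h \<otimes>\<^bsub>?A\<^esub> \<Theta> k"
      using \<Theta>_in[OF hk(1)] \<Theta>_in[OF hk(2)] by (simp add: order_Aut_def BijGroup_def)
  qed (rule \<Theta>_in)
  have inj: "inj_on \<Theta> (carrier G)"
  proof (rule inj_onI)
    fix h k assume hk: "h \<in> carrier G" "k \<in> carrier G" "\<Theta> h = \<Theta> k"
    from fun_cong[OF hk(3), of "Src \<one>"] hk show "h = k" by (simp add: \<Theta>_def)
  qed
  have surj: "f \<in> \<Theta> ` carrier G" if f: "f \<in> carrier ?A" for f
  proof -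
    have b: "bij_betw f ?Y ?Y" and ext: "f \<in> extensional ?Y"
      and f_le: "\<And>x y. x \<in> ?Y \<Longrightarrow> y \<in> ?Y \<Longrightarrow> ?R (f x) (f y) \<longleftrightarrow> ?R x y"
      using f by (auto simp: order_Aut_def Bij_def)
    have f_in: "f x \<in> ?Y" if "x \<in> ?Y" for x using b that by (auto simp: bij_betw_def)
    have f_eq: "f x = f y \<longleftrightarrow> x = y" if "x \<in> ?Y" "y \<in> ?Y" for x y
      using b that by (auto simp: bij_betw_def inj_on_def)
    have f_surj: "y \<in> f ` ?Y" if "y \<in> ?Y" for y
      using that by (simp add: bij_betw_imp_surj_on[OF b])
    obtain x where x: "x \<in> ?Y" "f x = Bot" using f_surj[of Bot] by auto
    have f_Bot: "f Bot = Bot"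
      using f_le[of Bot x] x by (simp add: node_le_Bot)
    obtain y where y: "y \<in> ?Y" "f y = Top" using f_surj[of Top] by auto
    have f_Top: "f Top = Top"
      using f_le[of y Top] y by (simp add: node_le_Top)
    \<comment> \<open>This describes the nodes \<open>Src a\<close> by the order, so that
      \<open>f\<close> must preserve them.\<close>
    define atom where "atom x \<longleftrightarrow> x \<noteq> Bot \<and> (\<forall>y\<in>?Y. ?R y x \<longrightarrow> y = Bot \<or> y = x)" for x
    have pos_surj: "\<exists>c\<in>carrier G. pos c = i" if "i < ?n" for i
    proof -
      have "i \<in> pos ` carrier G" using that by (simp add: bij_betw_imp_surj_on[OF pos])
      then show ?thesis by auto
    qed
    have atom_iff: "atom x \<longleftrightarrow> x \<in> range Src" if x: "x \<in> ?Y" for x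
    proof (cases x)
      case (Chain b j)
      \<comment> \<open>The element numbered 0 yields a source below the whole chain over
        \<open>b\<close>, so no chain node is an atom.\<close>
      obtain c where c: "c \<in> carrier G" "pos c = 0" using pos_surj[OF n] by blast
      have "inv (b \<otimes> inv c) \<otimes> b = c"
        using x c Chain by (simp add: inv_mult_group m_assoc)
      then have "?R (Src (b \<otimes> inv c)) x" using c Chain by simp
      moreover have "Src (b \<otimes> inv c) \<in> ?Y" using x c Chain by simp
      ultimately show ?thesis unfolding atom_def using Chain by blast
    next
      case (Src a)
      have "y = Bot \<or> y = Src a" if "?R y (Src a)" for y
        using that by (cases y) auto
      with Src show ?thesis by (auto simp: atom_def)
    next
      case Top
      have "Src \<one> \<in> ?Y" "?R (Src \<one>) Top" by auto
      with Top show ?thesis unfolding atom_def by blast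
    qed (simp add: atom_def image_iff)
    have "atom (f x) \<longleftrightarrow> atom x" if x: "x \<in> ?Y" for x
    proof -
      have "(\<forall>y\<in>?Y. ?R y (f x) \<longrightarrow> y = Bot \<or> y = f x) \<longleftrightarrow>
          (\<forall>y\<in>f ` ?Y. ?R y (f x) \<longrightarrow> y = Bot \<or> y = f x)"
        using b by (simp add: bij_betw_def)
      also have "\<dots> \<longleftrightarrow> (\<forall>y\<in>?Y. ?R y x \<longrightarrow> y = Bot \<or> y = x)"
        using x f_eq[of _ Bot] by (simp add: f_le f_eq f_Bot)
      finally show ?thesis using x f_eq[of x Bot] by (simp add: atom_def f_Bot)
    qed
    then have f_src: "f x \<in> range Src \<longleftrightarrow> x \<in> range Src" if "x \<in> ?Y" for x
      using atom_iff that f_in by blast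
    have "\<exists>a'\<in>carrier G. f (Src a) = Src a'" if "a \<in> carrier G" for a
      using f_src[of "Src a"] f_in[of "Src a"] that by auto
    then obtain \<theta> where \<theta>: "\<And>a. a \<in> carrier G \<Longrightarrow> \<theta> a \<in> carrier G \<and> f (Src a) = Src (\<theta> a)"
      by metis
    have "inj_on \<theta> (carrier G)"
    proof (rule inj_onI)
      fix a b assume ab: "a \<in> carrier G" "b \<in> carrier G" "\<theta> a = \<theta> b"
      then show "a = b" using f_eq[of "Src a" "Src b"] \<theta> by simp
    qed
    then have \<theta>_surj: "\<theta> ` carrier G = carrier G"
      using fin \<theta> by (intro endo_inj_surj) auto
    \<comment> \<open>\<open>f\<close> permutes the sources, so the number of sources below a node
      is invariant. On a chain it recovers the height, shifted by one.\<close>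
    define cnt where "cnt x = card {a \<in> carrier G. ?R (Src a) x}" for x
    have cnt_f: "cnt (f x) = cnt x" if x: "x \<in> ?Y" for x
    proof -
      have "{a \<in> \<theta> ` carrier G. ?R (Src a) (f x)} = \<theta> ` {a \<in> carrier G. ?R (Src (\<theta> a)) (f x)}"
        by blast
      also have "{a \<in> carrier G. ?R (Src (\<theta> a)) (f x)} = {a \<in> carrier G. ?R (Src a) x}"
      proof (intro Collect_cong conj_cong refl)
        show "?R (Src (\<theta> a)) (f x) \<longleftrightarrow> ?R (Src a) x" if "a \<in> carrier G" for a
          using f_le[of "Src a" x] \<theta>[OF that] that x by simp
      qed
      finally have "{a \<in> carrier G. ?R (Src a) (f x)} = \<theta> ` {a \<in> carrier G. ?R (Src a) x}"
        by (simp only: \<theta>_surj)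
      then show ?thesis
        using \<open>inj_on \<theta> (carrier G)\<close>
        by (simp add: cnt_def card_image inj_on_subset[of \<theta> "carrier G"])
    qed
    have cnt_Chain: "cnt (Chain b j) = Suc j" if b: "b \<in> carrier G" and j: "j < ?n" for b j
    proof -
      \<comment> \<open>As \<open>a\<close> runs through the group, \<open>inv a \<otimes> b\<close>
        takes every value once, so each number from 0 to \<open>j\<close> is attained once.\<close>
      have "bij_betw (\<lambda>a. pos (inv a \<otimes> b)) {a \<in> carrier G. pos (inv a \<otimes> b) \<le> j} {..j}"
        unfolding bij_betw_def
      proof
        show "inj_on (\<lambda>a. pos (inv a \<otimes> b)) {a \<in> carrier G. pos (inv a \<otimes> b) \<le> j}"
        proof (rule inj_onI)
          fix a a' assume a: "a \<in> {a \<in> carrier G. pos (inv a \<otimes> b) \<le> j}"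
            "a' \<in> {a \<in> carrier G. pos (inv a \<otimes> b) \<le> j}" "pos (inv a \<otimes> b) = pos (inv a' \<otimes> b)"
          then have "inv a \<otimes> b = inv a' \<otimes> b" using b by (intro pos_inj) auto
          then have "inv a = inv a'" using a b by simp
          then have "inv (inv a) = inv (inv a')" by simp
          then show "a = a'" using a by simp
        qed
        show "(\<lambda>a. pos (inv a \<otimes> b)) ` {a \<in> carrier G. pos (inv a \<otimes> b) \<le> j} = {..j}"
        proof
          show "{..j} \<subseteq> (\<lambda>a. pos (inv a \<otimes> b)) ` {a \<in> carrier G. pos (inv a \<otimes> b) \<le> j}"
          proof
            fix i assume i: "i \<in> {..j}"
            with j obtain c where c: "c \<in> carrier G" "pos c = i" using pos_surj[of i] by auto
            have "inv (b \<otimes> inv c) \<otimes> b = c" using b c by (simp add: inv_mult_group m_assoc)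
            with i b c show "i \<in> (\<lambda>a. pos (inv a \<otimes> b)) ` {a \<in> carrier G. pos (inv a \<otimes> b) \<le> j}"
              by (intro image_eqI[of _ _ "b \<otimes> inv c"]) auto
          qed
        qed auto
      qed
      from bij_betw_same_card[OF this] show ?thesis by (simp add: cnt_def)
    qed
    have "\<exists>b'\<in>carrier G. f (Chain b j) = Chain b' j" if bj: "b \<in> carrier G" "j < ?n" for b j
    proof -
      have Y: "Chain b j \<in> ?Y" using bj by simp
      have "f (Chain b j) \<noteq> Bot" "f (Chain b j) \<noteq> Top" "f (Chain b j) \<notin> range Src"
        using f_eq[OF Y, of Bot] f_eq[OF Y, of Top] f_src[OF Y] f_Bot f_Top by auto
      then obtain b' j' where c: "f (Chain b j) = Chain b' j'"
        by (cases "f (Chain b j)") auto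
      with f_in[OF Y] have b': "b' \<in> carrier G" "j' < ?n" by auto
      with c cnt_f[OF Y] bj have "j' = j" by (simp add: cnt_Chain)
      with c b' show ?thesis by blast
    qed
    then obtain \<psi> where \<psi>: "\<And>b j. b \<in> carrier G \<Longrightarrow> j < ?n \<Longrightarrow>
        \<psi> b j \<in> carrier G \<and> f (Chain b j) = Chain (\<psi> b j) j"
      by metis
    \<comment> \<open>Nodes of one chain are comparable and nodes of different chains are not, so
      \<open>f\<close> sends a chain into a single chain.\<close>
    have \<psi>_const: "\<psi> b j = \<psi> b 0" if "b \<in> carrier G" "j < ?n" for b j
      using f_le[of "Chain b 0" "Chain b j"] \<psi>[OF that] \<psi>[OF that(1) n] that n by simp
    have key: "inv (\<theta> a) \<otimes> \<psi> b 0 = inv a \<otimes> b" if ab: "a \<in> carrier G" "b \<in> carrier G" for a b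
    proof -
      have ab': "\<theta> a \<in> carrier G" "\<psi> b 0 \<in> carrier G" using \<theta>[OF ab(1)] \<psi>[OF ab(2) n] by auto
      have eq: "pos (inv (\<theta> a) \<otimes> \<psi> b 0) \<le> j \<longleftrightarrow> pos (inv a \<otimes> b) \<le> j" if j: "j < ?n" for j
        using f_le[of "Src a" "Chain b j"] \<theta>[OF ab(1)] \<psi>[OF ab(2) j] \<psi>_const[OF ab(2) j] ab j by simp
      have "pos (inv (\<theta> a) \<otimes> \<psi> b 0) < ?n" "pos (inv a \<otimes> b) < ?n"
        using ab ab' by (auto intro: pos_less)
      \<comment> \<open>Both numbers are below \<open>?n\<close> and satisfy the same bounds; using
        each as a bound for the other gives equality.\<close>
      with eq have "pos (inv (\<theta> a) \<otimes> \<psi> b 0) = pos (inv a \<otimes> b)" by (metis le_antisym le_refl)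
      then show ?thesis using ab ab' by (intro pos_inj) auto
    qed
    define h where "h = \<theta> \<one>"
    have h: "h \<in> carrier G" using \<theta> by (simp add: h_def)
    \<comment> \<open>Taking \<open>a = \<one>\<close> in \<open>key\<close> gives the action on
      chains; taking \<open>b = a\<close> then gives the action on sources.\<close>
    have \<psi>_eq: "\<psi> b 0 = h \<otimes> b" if "b \<in> carrier G" for b
      using key[OF one_closed that] \<psi>[OF that n] that h by (simp add: h_def[symmetric] inv_solve_left')
    have \<theta>_eq: "\<theta> a = h \<otimes> a" if a: "a \<in> carrier G" for a
      using key[OF a a] \<psi>_eq[OF a] \<theta>[OF a] h a by (simp add: inv_solve_left')
    have "f = \<Theta> h"
    proof (rule extensionalityI[OF ext])
      show "\<Theta> h \<in> extensional ?Y" by (simp add: \<Theta>_def)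
      fix x assume x: "x \<in> ?Y"
      show "f x = \<Theta> h x"
      proof (cases x)
        case (Src a)
        with x show ?thesis using \<theta>[of a] \<theta>_eq[of a] by (simp add: \<Theta>_def)
      next
        case (Chain b j)
        with x show ?thesis using \<psi>[of b j] \<psi>_const[of b j] \<psi>_eq[of b] by (simp add: \<Theta>_def)
      qed (simp_all add: \<Theta>_def f_Bot f_Top)
    qed
    with h show ?thesis by blast
  qed
  show ?thesis
    using hom inj surj \<Theta>_in by (intro is_isoI isoI) (auto simp: bij_betw_def)
qed

end

section \<open>Characteristic subgroups of an abelian p-group\<close>

text \<open>Reduction modulo \<open>p ^ a\<close> does not affect divisibility by
  \<open>p ^ e'\<close>, and \<open>w\<close> contributes no factor \<open>p\<close>. This bounds
  levels from below in \<open>level_generic\<close>.\<close>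

lemma prime_power_dvd_mod_imp_le:
  fixes w :: int
  assumes "Factorial_Ring.prime p" "\<not> int p dvd w" "e' \<le> a" "int p ^ e' dvd (int p ^ e * w) mod int p ^ a"
  shows "e' \<le> e"
proof (rule ccontr)
  assume "\<not> e' \<le> e"
  have "int p ^ e' dvd int p ^ e * w"
    using assms(4) dvd_mod_iff[OF le_imp_power_dvd[OF assms(3)], of "int p"] by simp
  then have "int p ^ Suc e dvd int p ^ e * w"
    by (rule power_le_dvd) (use \<open>\<not> e' \<le> e\<close> in simp)
  then have "int p dvd w"
    using prime_gt_0_nat[OF assms(1)] by (simp add: mult.commute[of "int p"])
  with assms(2) show False by simp
qed

text \<open>\<open>w = 1\<close> works unless \<open>u\<close> is 1 modulo \<open>p\<close>, and
  then \<open>w = 2\<close> works because \<open>p\<close> is odd. For \<open>p = 2\<close> and odd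
  \<open>u\<close> no \<open>w\<close> exists, since two odd numbers have an even sum.\<close>

lemma unit_split:
  fixes u :: int
  assumes "Factorial_Ring.prime p" "odd p"
  shows "\<exists>w. \<not> int p dvd w \<and> \<not> int p dvd u - w"
proof (cases "int p dvd u - 1")
  case False
  moreover have "\<not> int p dvd 1" using assms(1) by auto
  ultimately show ?thesis by blast
next
  case True
  have "p \<noteq> 2" using assms(2) by auto
  then have "2 < p" using prime_ge_2_nat[OF assms(1)] by simp
  then have "\<not> int p dvd 2" by (auto dest: zdvd_imp_le)
  moreover have "\<not> int p dvd u - 2"
  proof
    assume "int p dvd u - 2"
    with True have "int p dvd (u - 1) - (u - 2)" by (rule dvd_diff)
    then show False using assms(1) by auto
  qed
  ultimately show ?thesis by blast
qed

lemma card_multiples: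
  fixes p :: nat
  assumes "0 < p" "e \<le> a"
  shows "card {z \<in> {0..<int p ^ a}. int p ^ e dvd z} = p ^ (a - e)"
proof -
  have a: "int p ^ a = int p ^ e * int p ^ (a - e)"
    using assms(2) by (simp add: power_add[symmetric])
  have pos: "0 < int p ^ e" using assms(1) by simp
  have "bij_betw (\<lambda>t. int p ^ e * t) {0..<int p ^ (a - e)} {z \<in> {0..<int p ^ a}. int p ^ e dvd z}"
  proof (rule bij_betwI[where g = "\<lambda>z. z div int p ^ e"])
    show "(\<lambda>t. int p ^ e * t) \<in> {0..<int p ^ (a - e)} \<rightarrow> {z \<in> {0..<int p ^ a}. int p ^ e dvd z}"
      using pos by (simp add: a)
    show "(\<lambda>z. z div int p ^ e) \<in> {z \<in> {0..<int p ^ a}. int p ^ e dvd z} \<rightarrow> {0..<int p ^ (a - e)}"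
    proof
      fix z assume z: "z \<in> {z \<in> {0..<int p ^ a}. int p ^ e dvd z}"
      then obtain t where "z = int p ^ e * t" by (auto elim: dvdE)
      with z pos show "z div int p ^ e \<in> {0..<int p ^ (a - e)}"
        by (simp add: a zero_le_mult_iff)
    qed
  qed (use pos in auto)
  from bij_betw_same_card[OF this] show ?thesis by (simp add: nat_power_eq)
qed

lemma comm_group_product_group:
  assumes "\<And>i. i \<in> I \<Longrightarrow> comm_group (G i)"
  shows "comm_group (product_group I G)"
proof -
  have "group (product_group I G)" using assms by (simp add: comm_group.axioms)
  then show ?thesis
  proof (rule group.group_comm_groupI)
    fix x y assume "x \<in> carrier (product_group I G)" "y \<in> carrier (product_group I G)"
    then show "x \<otimes>\<^bsub>product_group I G\<^esub> y = y \<otimes>\<^bsub>product_group I G\<^esub> x"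
      by (auto intro!: restrict_ext comm_monoid.m_comm comm_group.axioms assms)
  qed
qed

section \<open>The abelian p-group attached to a finite poset\<close>

locale poset_group = finite_poset Y R for Y :: "'y set" and R +
  fixes p :: nat and idx :: "'y \<Rightarrow> nat" and bot top
  assumes p: "Factorial_Ring.prime p" "odd p"
    and idx: "inj_on idx Y"
    and bot: "bot \<in> Y" "\<And>y. y \<in> Y \<Longrightarrow> R bot y"
    and top: "top \<in> Y" "\<And>y. y \<in> Y \<Longrightarrow> R y top"
begin

text \<open>By the doubling, indices that differ by \<open>d > 0\<close> have heights that differ by
  at least \<open>d + 1\<close>, as \<open>expo_mono\<close> requires.\<close>

definition height :: "'y \<Rightarrow> nat" where
  "height i = 2 * idx i + 2"

text \<open>
  The exceptional values turn \<open>{}\<close> and \<open>Y\<close> into the trivial subgroup and the whole group.  They are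
  compatible with the lattice operations on down-sets, since all nonempty ones contain \<open>bot\<close> and only \<open>Y\<close>
  contains \<open>top\<close>.
\<close>

definition expo :: "'y set \<Rightarrow> 'y \<Rightarrow> nat" where
  "expo D i = (if D = {} then height i else if D = Y then 0 else if i \<in> D then idx i else idx i + 1)"

definition Q :: "('y \<Rightarrow> int) monoid" where
  "Q = product_group Y (\<lambda>i. integer_mod_group (p ^ height i))"

definition ideal_sub :: "'y set \<Rightarrow> ('y \<Rightarrow> int) set" where
  "ideal_sub D = {x \<in> carrier Q. \<forall>i\<in>Y. int p ^ expo D i dvd x i}"

definition level :: "('y \<Rightarrow> int) \<Rightarrow> 'y set" where
  "level x = \<Inter>{D \<in> downsets Y R. x \<in> ideal_sub D}"

lemma p_pos: "0 < p" using p(1) prime_gt_0_nat by blast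

lemma carrier_Q: "carrier Q = (\<Pi>\<^sub>E i\<in>Y. {0..<int p ^ height i})"
  using p_pos by (auto simp: Q_def carrier_integer_mod_group intro!: PiE_cong)

lemma carrier_QD: "x \<in> carrier Q \<Longrightarrow> i \<in> Y \<Longrightarrow> 0 \<le> x i \<and> x i < int p ^ height i"
  by (auto simp: carrier_Q PiE_iff)

lemma one_Q: "\<one>\<^bsub>Q\<^esub> = (\<lambda>i\<in>Y. 0)"
  by (simp add: Q_def)

lemma mult_Q: "x \<otimes>\<^bsub>Q\<^esub> y = (\<lambda>i\<in>Y. (x i + y i) mod int p ^ height i)"
  by (simp add: Q_def)

lemma inv_Q:
  assumes "x \<in> carrier Q"
  shows "inv\<^bsub>Q\<^esub> x = (\<lambda>i\<in>Y. (- x i) mod int p ^ height i)"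
  using assms unfolding Q_def by (auto simp: PiE_iff intro!: restrict_ext)

lemma comm_group_Q: "comm_group Q"
  unfolding Q_def by (rule comm_group_product_group) simp

sublocale Q: comm_group Q by (rule comm_group_Q)

lemma finite_Q: "finite (carrier Q)"
  by (simp add: carrier_Q finite_Y finite_PiE)

lemma pow_Q:
  assumes "x \<in> carrier Q"
  shows "x [^]\<^bsub>Q\<^esub> (n :: nat) = (\<lambda>i\<in>Y. (int n * x i) mod int p ^ height i)"
proof (induction n)
  case (Suc n)
  then show ?case
    by (auto simp: mult_Q algebra_simps mod_simps intro!: restrict_ext)
qed (simp add: one_Q)

lemma expo_le: "expo D i \<le> height i"
  by (simp add: expo_def height_def)

lemma expo_empty: "expo {} i = height i"
  by (simp add: expo_def)

lemma expo_whole: "expo Y i = 0"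
  using bot(1) by (auto simp: expo_def)

lemma downsetsD:
  assumes "D \<in> downsets Y R"
  shows "D \<subseteq> Y" and "D \<noteq> {} \<Longrightarrow> bot \<in> D" and "top \<in> D \<Longrightarrow> D = Y"
  using assms bot top unfolding downsets_def by blast+

lemma downsets_Int: "A \<in> downsets Y R \<Longrightarrow> B \<in> downsets Y R \<Longrightarrow> A \<inter> B \<in> downsets Y R"
  and downsets_Un: "A \<in> downsets Y R \<Longrightarrow> B \<in> downsets Y R \<Longrightarrow> A \<union> B \<in> downsets Y R"
  and empty_downset: "{} \<in> downsets Y R"
  and whole_downset: "Y \<in> downsets Y R"
  unfolding downsets_def by blast+

text \<open>A point \<open>i\<close> of \<open>A\<close> has exponent at most \<open>idx i\<close>,
  and a point of \<open>Y\<close> outside \<open>B\<close> at least \<open>idx i + 1\<close>. Thus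
  exponents detect inclusion, and smaller exponents mean larger subgroups.\<close>

lemma expo_le_iff:
  assumes "A \<subseteq> Y" "B \<subseteq> Y"
  shows "(\<forall>i\<in>Y. expo B i \<le> expo A i) \<longleftrightarrow> A \<subseteq> B"
proof
  assume le: "\<forall>i\<in>Y. expo B i \<le> expo A i"
  show "A \<subseteq> B"
  proof
    fix i assume i: "i \<in> A"
    with assms le have "i \<in> Y" "expo B i \<le> expo A i" by auto
    with i show "i \<in> B"
      by (auto simp: expo_def height_def split: if_splits)
  qed
next
  assume "A \<subseteq> B"
  with assms show "\<forall>i\<in>Y. expo B i \<le> expo A i"
    by (auto simp: expo_def height_def)
qed

lemma expo_Int:
  assumes A: "A \<in> downsets Y R" and B: "B \<in> downsets Y R" and i: "i \<in> Y"
  shows "expo (A \<inter> B) i = max (expo A i) (expo B i)"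
proof (cases "A = {} \<or> B = {}")
  case True
  then show ?thesis by (auto simp: expo_empty expo_le max_absorb1 max_absorb2)
next
  case False
  then have "A \<inter> B \<noteq> {}" using downsetsD(2)[OF A] downsetsD(2)[OF B] by blast
  moreover have "A \<inter> B = Y \<longleftrightarrow> A = Y \<and> B = Y"
    using downsetsD(1)[OF A] downsetsD(1)[OF B] by blast
  ultimately show ?thesis using False i by (auto simp: expo_def)
qed

lemma expo_Un:
  assumes A: "A \<in> downsets Y R" and B: "B \<in> downsets Y R" and i: "i \<in> Y"
  shows "expo (A \<union> B) i = min (expo A i) (expo B i)"
proof (cases "A = {} \<or> B = {}")
  case True
  then show ?thesis by (auto simp: expo_empty expo_le min_absorb1 min_absorb2)
next
  case False
  have "A \<union> B = Y \<longleftrightarrow> A = Y \<or> B = Y"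
    using downsetsD(1,3)[OF A] downsetsD(1,3)[OF B] top(1) by blast
  with False i show ?thesis by (auto simp: expo_def)
qed

text \<open>These are the conditions for every homomorphism from the cyclic factor \<open>k\<close>
  to the factor \<open>i\<close> to map multiples of \<open>p ^ expo D k\<close> to multiples of
  \<open>p ^ expo D i\<close>. They are why \<open>ideal_sub D\<close> is characteristic.\<close>

lemma expo_mono:
  assumes "i \<in> Y" "k \<in> Y"
  shows "idx k \<le> idx i \<Longrightarrow> height k + expo D i \<le> height i + expo D k"
    and "idx i < idx k \<Longrightarrow> expo D i \<le> expo D k"
proof -
  assume le: "idx k \<le> idx i"
  show "height k + expo D i \<le> height i + expo D k"
  proof (cases "k = i")
    case False
    with le idx assms have "idx k < idx i" by (auto simp: inj_on_def le_less)
    then show ?thesis by (auto simp: expo_def height_def)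
  qed simp
qed (auto simp: expo_def height_def)

section \<open>The subgroups of the down-sets and the level of an element\<close>

lemma ideal_sub_Int:
  assumes "A \<in> downsets Y R" "B \<in> downsets Y R"
  shows "ideal_sub A \<inter> ideal_sub B = ideal_sub (A \<inter> B)"
proof -
  have "int p ^ max m n dvd z \<longleftrightarrow> int p ^ m dvd z \<and> int p ^ n dvd z" for m n z
    by (cases "m \<le> n") (auto simp: max_def intro: power_le_dvd)
  then show ?thesis using assms by (auto simp: ideal_sub_def expo_Int)
qed

lemma ideal_sub_mono: "A \<subseteq> B \<Longrightarrow> B \<subseteq> Y \<Longrightarrow> ideal_sub A \<subseteq> ideal_sub B"
  using expo_le_iff[of A B] by (auto simp: ideal_sub_def intro: power_le_dvd)

lemma ideal_sub_whole: "ideal_sub Y = carrier Q"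
  by (simp add: ideal_sub_def expo_whole)

lemma ideal_sub_empty: "ideal_sub {} = {\<one>\<^bsub>Q\<^esub>}"
proof -
  have "x i = 0" if "x \<in> ideal_sub {}" "i \<in> Y" for x i
  proof -
    have "x i = x i mod int p ^ height i"
      using that carrier_QD[of x i] by (simp add: ideal_sub_def)
    also have "\<dots> = 0" using that by (simp add: ideal_sub_def expo_empty)
    finally show ?thesis .
  qed
  then have "x = \<one>\<^bsub>Q\<^esub>" if "x \<in> ideal_sub {}" for x
    using that by (intro extensionalityI[of x Y]) (auto simp: one_Q ideal_sub_def carrier_Q PiE_iff)
  moreover have "\<one>\<^bsub>Q\<^esub> \<in> ideal_sub {}"
    using Q.one_closed unfolding ideal_sub_def by (simp add: one_Q)
  ultimately show ?thesis by blast
qed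

lemma ideal_sub_mult: "x \<in> ideal_sub D \<Longrightarrow> y \<in> ideal_sub D \<Longrightarrow> x \<otimes>\<^bsub>Q\<^esub> y \<in> ideal_sub D"
  using Q.m_closed[of x y]
  by (auto simp: ideal_sub_def mult_Q dvd_mod_iff[OF le_imp_power_dvd[OF expo_le]])

lemma ideal_sub_inv: "x \<in> ideal_sub D \<Longrightarrow> inv\<^bsub>Q\<^esub> x \<in> ideal_sub D"
  using Q.inv_closed[of x]
  by (auto simp: ideal_sub_def inv_Q dvd_mod_iff[OF le_imp_power_dvd[OF expo_le]])

text \<open>The down-sets whose subgroup contains \<open>x\<close> include \<open>Y\<close> and are
  closed under intersection, so a minimal one is the least.\<close>

lemma level:
  assumes x: "x \<in> carrier Q"
  shows "level x \<in> downsets Y R" and "x \<in> ideal_sub (level x)"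
proof -
  let ?\<D> = "{D \<in> downsets Y R. x \<in> ideal_sub D}"
  have "?\<D> \<subseteq> Pow Y" using downsetsD(1) by blast
  then have "finite ?\<D>" using finite_Y by (simp add: finite_subset)
  moreover have "Y \<in> ?\<D>" using x by (simp add: whole_downset ideal_sub_whole)
  ultimately obtain M where M: "M \<in> ?\<D>" and min: "\<And>D. D \<in> ?\<D> \<Longrightarrow> D \<subseteq> M \<Longrightarrow> M = D"
    using finite_has_minimal[of ?\<D>] by blast
  have "M \<subseteq> D" if D: "D \<in> ?\<D>" for D
  proof -
    have "M \<inter> D \<in> ?\<D>" using M D by (auto simp: downsets_Int ideal_sub_Int[symmetric])
    then have "M = M \<inter> D" by (rule min) simp
    then show ?thesis by blast
  qed
  then have "level x = M" unfolding level_def using M by blast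
  with M show "level x \<in> downsets Y R" "x \<in> ideal_sub (level x)" by simp_all
qed

lemma level_subset_iff:
  assumes "x \<in> carrier Q" "D \<in> downsets Y R"
  shows "level x \<subseteq> D \<longleftrightarrow> x \<in> ideal_sub D"
proof
  show "x \<in> ideal_sub D" if "level x \<subseteq> D"
    using ideal_sub_mono[OF that] level(2)[OF assms(1)] downsetsD(1)[OF assms(2)] by blast
  show "level x \<subseteq> D" if "x \<in> ideal_sub D"
    using that assms(2) unfolding level_def by blast
qed

text \<open>This describes the subgroup by conditions that every endomorphism of the group preserves.\<close>

lemma ideal_sub_iff_powers:
  assumes x: "x \<in> carrier Q"
  shows "x \<in> ideal_sub D \<longleftrightarrow>
    (\<forall>i\<in>Y. \<exists>y\<in>carrier Q. x [^]\<^bsub>Q\<^esub> (p ^ (height i - expo D i)) = y [^]\<^bsub>Q\<^esub> (p ^ height i))"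
proof
  assume xD: "x \<in> ideal_sub D"
  show "\<forall>i\<in>Y. \<exists>y\<in>carrier Q. x [^]\<^bsub>Q\<^esub> (p ^ (height i - expo D i)) = y [^]\<^bsub>Q\<^esub> (p ^ height i)"
  proof
    fix i assume i: "i \<in> Y"
    \<comment> \<open>The required root is built coordinatewise: in factors no longer than the
      \<open>i\<close>-th both powers vanish, and in the longer ones \<open>x k\<close> is divisible
      by \<open>p ^ expo D i\<close>.\<close>
    define y where "y = (\<lambda>k\<in>Y. if idx k \<le> idx i then 0 else x k div int p ^ expo D i)"
    have "x k div int p ^ expo D i < int p ^ height k" if "k \<in> Y" for k
      using carrier_QD[OF x that] p_pos zdiv_mono2[of "x k" 1 "int p ^ expo D i"] by force
    then have y: "y \<in> carrier Q"
      using carrier_QD[OF x] p_pos by (auto simp: y_def carrier_Q pos_imp_zdiv_nonneg_iff)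
    have "(int p ^ (height i - expo D i) * x k) mod int p ^ height k =
        (int p ^ height i * y k) mod int p ^ height k" if k: "k \<in> Y" for k
    proof (cases "idx k \<le> idx i")
      case True
      have "int p ^ expo D k dvd x k" using xD k by (simp add: ideal_sub_def)
      then have "int p ^ (height i - expo D i) * int p ^ expo D k dvd
          int p ^ (height i - expo D i) * x k"
        by (rule mult_dvd_mono[OF dvd_refl])
      moreover have "height k \<le> height i - expo D i + expo D k"
        using expo_mono(1)[OF i k True, of D] expo_le[of D i] by linarith
      ultimately have "int p ^ height k dvd int p ^ (height i - expo D i) * x k"
        by (simp add: power_add[symmetric] power_le_dvd)
      with True k show ?thesis by (simp add: y_def)
    next
      case False
      then have "int p ^ expo D i dvd x k"
        using xD k expo_mono(2)[OF i k, of D] by (auto simp: ideal_sub_def intro: power_le_dvd)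
      then have "x k = int p ^ expo D i * y k" using False k by (simp add: y_def)
      then have "int p ^ (height i - expo D i) * x k = int p ^ height i * y k"
        using expo_le[of D i] by (simp add: mult.assoc[symmetric] power_add[symmetric])
      then show ?thesis by simp
    qed
    then have "x [^]\<^bsub>Q\<^esub> (p ^ (height i - expo D i)) = y [^]\<^bsub>Q\<^esub> (p ^ height i)"
      using x y by (auto simp: pow_Q intro!: restrict_ext)
    with y show "\<exists>y\<in>carrier Q. x [^]\<^bsub>Q\<^esub> (p ^ (height i - expo D i)) = y [^]\<^bsub>Q\<^esub> (p ^ height i)"
      by blast
  qed
next
  assume *: "\<forall>i\<in>Y. \<exists>y\<in>carrier Q. x [^]\<^bsub>Q\<^esub> (p ^ (height i - expo D i)) = y [^]\<^bsub>Q\<^esub> (p ^ height i)"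
  have "int p ^ expo D i dvd x i" if i: "i \<in> Y" for i
  proof -
    obtain y where y: "y \<in> carrier Q"
      "x [^]\<^bsub>Q\<^esub> (p ^ (height i - expo D i)) = y [^]\<^bsub>Q\<^esub> (p ^ height i)"
      using * i by blast
    \<comment> \<open>In the \<open>i\<close>-th coordinate every \<open>p ^ height i\<close>-th
      power is trivial, which turns the equation into divisibility of \<open>x i\<close>.\<close>
    from fun_cong[OF y(2), of i]
    have "(int p ^ (height i - expo D i) * x i) mod int p ^ height i = 0"
      using i x y(1) by (simp add: pow_Q)
    then have "int p ^ height i dvd int p ^ (height i - expo D i) * x i" by presburger
    moreover have "int p ^ height i = int p ^ (height i - expo D i) * int p ^ expo D i"
      using expo_le[of D i] by (simp add: power_add[symmetric])
    ultimately show ?thesis using p_pos by simp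
  qed
  with x show "x \<in> ideal_sub D" by (simp add: ideal_sub_def)
qed

text \<open>Homomorphisms commute with powers, so \<open>\<phi>\<close> maps the subgroup into
  itself; finiteness and injectivity upgrade this to equality.\<close>

lemma auto_ideal_sub_iff:
  assumes \<phi>: "\<phi> \<in> auto Q" and x: "x \<in> carrier Q"
  shows "\<phi> x \<in> ideal_sub D \<longleftrightarrow> x \<in> ideal_sub D"
proof -
  have hom: "\<phi> \<in> hom Q Q" and bij: "bij_betw \<phi> (carrier Q) (carrier Q)"
    using \<phi> by (auto simp: auto_def Bij_def)
  interpret \<phi>: group_hom Q Q \<phi> by unfold_locales (rule hom)
  have closed: "\<phi> x \<in> ideal_sub D" if "x \<in> ideal_sub D" for x
  proof -
    have x: "x \<in> carrier Q" using that by (simp add: ideal_sub_def)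
    have "\<exists>y\<in>carrier Q. \<phi> x [^]\<^bsub>Q\<^esub> (p ^ (height i - expo D i)) = y [^]\<^bsub>Q\<^esub> (p ^ height i)"
      if i: "i \<in> Y" for i
    proof -
      obtain y where y: "y \<in> carrier Q"
        "x [^]\<^bsub>Q\<^esub> (p ^ (height i - expo D i)) = y [^]\<^bsub>Q\<^esub> (p ^ height i)"
        using \<open>x \<in> ideal_sub D\<close> i ideal_sub_iff_powers[OF x] by blast
      have "\<phi> x [^]\<^bsub>Q\<^esub> (p ^ (height i - expo D i)) = \<phi> y [^]\<^bsub>Q\<^esub> (p ^ height i)"
        using x y by (simp add: \<phi>.hom_nat_pow[symmetric])
      then show ?thesis using y(1) by (intro bexI[of _ "\<phi> y"]) simp_all
    qed
    then show ?thesis using x ideal_sub_iff_powers[of "\<phi> x"] by simp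
  qed
  have "ideal_sub D \<subseteq> carrier Q" by (auto simp: ideal_sub_def)
  then have "finite (ideal_sub D)" "inj_on \<phi> (ideal_sub D)"
    using finite_Q bij by (auto simp: bij_betw_def intro: finite_subset inj_on_subset)
  then have "\<phi> ` ideal_sub D = ideal_sub D"
    using closed by (intro endo_inj_surj) auto
  then show ?thesis
    using inj_on_image_mem_iff[OF bij_betw_imp_inj_on[OF bij] x \<open>ideal_sub D \<subseteq> carrier Q\<close>] by simp
qed

text \<open>After \<open>p ^ expo D i\<close> is factored out of every coordinate,
  \<open>unit_split\<close> writes the quotient as a sum of two numbers prime to \<open>p\<close>.
  Multiplying the powers \<open>p ^ expo D i\<close> by such numbers gives an element of level
  exactly \<open>D\<close>, as a smaller down-set would require a larger exponent somewhere.\<close>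

lemma level_generic:
  assumes x: "x \<in> carrier Q" and D: "D \<in> downsets Y R" and xD: "x \<in> ideal_sub D"
  shows "\<exists>y\<in>carrier Q. \<exists>z\<in>carrier Q. level y = D \<and> level z = D \<and> x = y \<otimes>\<^bsub>Q\<^esub> z"
proof -
  have "\<exists>w. \<not> int p dvd w \<and> \<not> int p dvd x i div int p ^ expo D i - w" for i
    using unit_split[OF p] by blast
  then obtain w where w: "\<And>i. \<not> int p dvd w i" "\<And>i. \<not> int p dvd x i div int p ^ expo D i - w i"
    by metis
  define mk where "mk v = (\<lambda>i\<in>Y. (int p ^ expo D i * v i) mod int p ^ height i)" for v
  have mk: "mk v \<in> carrier Q" "level (mk v) = D" if v: "\<And>i. \<not> int p dvd v i" for v
  proof -
    show c: "mk v \<in> carrier Q" using p_pos by (auto simp: mk_def carrier_Q)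
    have "mk v \<in> ideal_sub D"
      using c by (auto simp: ideal_sub_def mk_def dvd_mod_iff[OF le_imp_power_dvd[OF expo_le]])
    then have 1: "level (mk v) \<subseteq> D" by (simp add: level_subset_iff c D)
    have "expo (level (mk v)) i \<le> expo D i" if i: "i \<in> Y" for i
    proof (rule prime_power_dvd_mod_imp_le[OF p(1) v expo_le])
      show "int p ^ expo (level (mk v)) i dvd (int p ^ expo D i * v i) mod int p ^ height i"
        using level(2)[OF c] i by (simp add: ideal_sub_def mk_def)
    qed
    then have "D \<subseteq> level (mk v)"
      using expo_le_iff[OF downsetsD(1)[OF D] downsetsD(1)[OF level(1)[OF c]]] by blast
    with 1 show "level (mk v) = D" by blast
  qed
  let ?y = "mk w" and ?z = "mk (\<lambda>i. x i div int p ^ expo D i - w i)"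
  have "x = ?y \<otimes>\<^bsub>Q\<^esub> ?z"
  proof (rule extensionalityI[of x Y])
    show "x \<in> extensional Y" using x by (auto simp: carrier_Q PiE_iff)
    show "?y \<otimes>\<^bsub>Q\<^esub> ?z \<in> extensional Y" by (simp add: mult_Q)
    fix i assume i: "i \<in> Y"
    have "int p ^ expo D i * (x i div int p ^ expo D i) = x i"
      using xD i by (simp add: ideal_sub_def)
    then have "x i = int p ^ expo D i * w i + int p ^ expo D i * (x i div int p ^ expo D i - w i)"
      by (simp add: right_diff_distrib)
    moreover have "x i mod int p ^ height i = x i" using carrier_QD[OF x i] by simp
    ultimately show "x i = (?y \<otimes>\<^bsub>Q\<^esub> ?z) i"
      using i by (simp add: mult_Q mk_def mod_add_eq)
  qed
  then show ?thesis
    using mk[of w] mk[of "\<lambda>i. x i div int p ^ expo D i - w i"] w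
    by (intro bexI[of _ ?y] bexI[of _ ?z]) auto
qed

lemma graded_group_Q: "graded_group Q (downsets Y R) level"
proof (intro graded_group.intro graded_group_axioms.intro)
  show "comm_group Q" by (rule comm_group_Q)
  show "finite (carrier Q)" by (rule finite_Q)
  fix g assume g: "g \<in> carrier Q"
  show "level g \<in> downsets Y R" by (rule level(1)[OF g])
  show "level g = {} \<longleftrightarrow> g = \<one>\<^bsub>Q\<^esub>"
    using level_subset_iff[OF g empty_downset] by (simp add: ideal_sub_empty)
  have "level (inv\<^bsub>Q\<^esub> x) \<subseteq> level x" if "x \<in> carrier Q" for x
    using level_subset_iff[of "inv\<^bsub>Q\<^esub> x" "level x"] level[OF that] that by (simp add: ideal_sub_inv)
  from this[OF g] this[of "inv\<^bsub>Q\<^esub> g"] g show "level (inv\<^bsub>Q\<^esub> g) = level g" by auto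
  show "level (g \<otimes>\<^bsub>Q\<^esub> h) \<subseteq> level g \<union> level h" if h: "h \<in> carrier Q" for h
  proof -
    have U: "level g \<union> level h \<in> downsets Y R" using level(1) g h by (simp add: downsets_Un)
    have "g \<in> ideal_sub (level g \<union> level h)" "h \<in> ideal_sub (level g \<union> level h)"
      using level_subset_iff[OF g U] level_subset_iff[OF h U] by auto
    then show ?thesis
      using level_subset_iff[OF _ U, of "g \<otimes>\<^bsub>Q\<^esub> h"] g h by (simp add: ideal_sub_mult)
  qed
  show "level (\<phi> g) = level g" if \<phi>: "\<phi> \<in> auto Q" for \<phi>
    using auto_ideal_sub_iff[OF \<phi> g] by (simp add: level_def)
  fix A B assume A: "A \<in> downsets Y R"
  show "\<exists>a\<in>carrier Q. \<exists>b\<in>carrier Q. level a = A \<and> level b = A \<and> g = a \<otimes>\<^bsub>Q\<^esub> b"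
    if "level g \<subseteq> A"
    using that level_generic[OF g A] by (simp add: level_subset_iff[OF g A])
  assume B: "B \<in> downsets Y R" and AB: "level g \<subseteq> A \<union> B"
  \<comment> \<open>Each coordinate goes to the factor with the smaller exponent, which by
    \<open>expo_Un\<close> is the exponent of \<open>A \<union> B\<close> there.\<close>
  define a where "a = (\<lambda>i\<in>Y. if expo A i \<le> expo B i then g i else 0)"
  define b where "b = (\<lambda>i\<in>Y. if expo A i \<le> expo B i then 0 else g i)"
  have a: "a \<in> carrier Q" and b: "b \<in> carrier Q"
    using carrier_QD[OF g] p_pos by (auto simp: a_def b_def carrier_Q)
  have "g \<in> ideal_sub (A \<union> B)"
    using AB level_subset_iff[OF g downsets_Un[OF A B]] by simp
  then have "a \<in> ideal_sub A" "b \<in> ideal_sub B"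
    using a b by (auto simp: ideal_sub_def a_def b_def expo_Un[OF A B] min_def)
  then have "level a \<subseteq> A" "level b \<subseteq> B"
    using a b A B by (simp_all add: level_subset_iff)
  moreover have "g = a \<otimes>\<^bsub>Q\<^esub> b"
    using g carrier_QD[OF g]
    by (intro extensionalityI[of g Y]) (auto simp: carrier_Q PiE_iff mult_Q a_def b_def)
  ultimately show "\<exists>a\<in>carrier Q. \<exists>b\<in>carrier Q. level a \<subseteq> A \<and> level b \<subseteq> B \<and> g = a \<otimes>\<^bsub>Q\<^esub> b"
    using a b by blast
qed (simp_all add: downsets_Int downsets_Un)

lemma card_ideal_sub: "card (ideal_sub D) = p ^ (\<Sum>i\<in>Y. height i - expo D i)"
proof -
  have "ideal_sub D = (\<Pi>\<^sub>E i\<in>Y. {z \<in> {0..<int p ^ height i}. int p ^ expo D i dvd z})"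
    by (auto simp: ideal_sub_def carrier_Q PiE_iff extensional_def)
  then have "card (ideal_sub D) = (\<Prod>i\<in>Y. p ^ (height i - expo D i))"
    by (simp only: card_PiE[OF finite_Y] card_multiples[OF p_pos expo_le])
  then show ?thesis by (simp add: power_sum)
qed

lemma order_Q: "order Q = p ^ (\<Sum>i\<in>Y. height i)"
  using card_ideal_sub[of Y] by (simp add: ideal_sub_whole order_def expo_whole)

text \<open>Apart from the two exceptional sets, which \<open>f\<close> fixes, the order of the
  subgroup depends on \<open>D\<close> only through its cardinality.\<close>

lemma card_ideal_sub_image:
  assumes f: "f \<in> carrier (order_Aut Y R)" and D: "D \<in> downsets Y R"
  shows "card (ideal_sub (f ` D)) = card (ideal_sub D)"
proof -
  have b: "bij_betw f Y Y" using f by (simp add: order_Aut_def Bij_def)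
  have DY: "D \<subseteq> Y" using downsetsD(1)[OF D] .
  have fY: "f ` D \<subseteq> Y" using downsetsD(1)[OF image_downset[OF f D]] .
  have card: "card (f ` D) = card D"
    using b DY by (auto simp: bij_betw_def intro: card_image inj_on_subset)
  consider "D = {}" | "D = Y" | "D \<noteq> {}" "D \<noteq> Y" by blast
  then show ?thesis
  proof cases
    case 2
    then show ?thesis using b by (simp add: bij_betw_imp_surj_on)
  next
    case 3
    \<comment> \<open>Each point of \<open>Y\<close> contributes \<open>idx i + 1\<close>, and each
      point of \<open>E\<close> one more.\<close>
    have sum: "(\<Sum>i\<in>Y. height i - expo E i) = (\<Sum>i\<in>Y. idx i + 1) + card E"
      if E: "E \<noteq> {}" "E \<noteq> Y" "E \<subseteq> Y" for E
    proof -
      have "(\<Sum>i\<in>Y. height i - expo E i) = (\<Sum>i\<in>Y. (idx i + 1) + (if i \<in> E then 1 else 0))"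
        using E by (intro sum.cong) (auto simp: expo_def height_def)
      also have "\<dots> = (\<Sum>i\<in>Y. idx i + 1) + (\<Sum>i\<in>Y. if i \<in> E then 1 else 0)"
        by (rule sum.distrib)
      also have "(\<Sum>i\<in>Y. if i \<in> E then 1 else 0) = card (Y \<inter> E)"
        using finite_Y by (subst sum.inter_restrict[symmetric]) auto
      finally show ?thesis using E by (simp add: Int_absorb1)
    qed
    have "f ` D \<noteq> Y"
    proof
      assume "f ` D = Y"
      then have "D = Y" using card DY finite_Y by (metis card_subset_eq)
      with 3 show False by simp
    qed
    then show ?thesis using 3 DY fY by (simp add: card_ideal_sub sum card)
  qed simp
qed

end

section \<open>Transfer of the structure along an injection\<close>

lemma graded_group_image_group:
  assumes "graded_group P J lev" and inj: "inj_on h (carrier P)"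
  shows "graded_group (image_group h P) J (lev \<circ> inv_into (carrier P) h)"
proof -
  interpret P: graded_group P J lev by fact
  let ?Q = "image_group h P" and ?k = "inv_into (carrier P) h"
  have iso: "h \<in> iso P ?Q" using inj by (rule inj_imp_image_group_iso)
  have kh [simp]: "?k (h g) = g" if "g \<in> carrier P" for g using inj that by simp
  have [simp]: "carrier ?Q = h ` carrier P" by (rule image_group_carrier)
  have mult: "x \<otimes>\<^bsub>?Q\<^esub> y = h (?k x \<otimes>\<^bsub>P\<^esub> ?k y)" for x y by (simp add: image_group_def)
  have "group ?Q" using inj by (rule P.inj_imp_image_group_is_group)
  then interpret Q: group ?Q .
  have "comm_group ?Q"
    by (rule P.iso_imp_comm_group[OF is_isoI[OF iso]]) (rule Q.is_monoid)
  interpret h: group_hom P ?Q h using iso by unfold_locales (simp add: iso_def)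
  have eq_iff: "h a = h b \<longleftrightarrow> a = b" if "a \<in> carrier P" "b \<in> carrier P" for a b
    using inj that by (auto simp: inj_on_def)
  show ?thesis
  proof (intro graded_group.intro graded_group_axioms.intro)
    show "comm_group ?Q" by fact
    show "finite (carrier ?Q)" using P.finite_P by simp
    fix x assume "x \<in> carrier ?Q"
    then obtain g where g: "g \<in> carrier P" "x = h g" by auto
    show "(lev \<circ> ?k) x \<in> J" using g by (simp add: P.lev_in_J)
    show "(lev \<circ> ?k) x = {} \<longleftrightarrow> x = \<one>\<^bsub>?Q\<^esub>"
      using g P.lev_eq_empty[of g] eq_iff[OF g(1) P.one_closed] by simp
    show "(lev \<circ> ?k) (inv\<^bsub>?Q\<^esub> x) = (lev \<circ> ?k) x"
      using g by (simp add: h.hom_inv[symmetric] P.lev_inv del: h.hom_inv)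
    show "(lev \<circ> ?k) (x \<otimes>\<^bsub>?Q\<^esub> y) \<subseteq> (lev \<circ> ?k) x \<union> (lev \<circ> ?k) y" if y: "y \<in> carrier ?Q" for y
    proof -
      obtain g' where "g' \<in> carrier P" "y = h g'" using y by auto
      then show ?thesis using g P.lev_mult[of g g'] by (simp add: mult del: h.hom_mult)
    qed
    show "(lev \<circ> ?k) (\<phi> x) = (lev \<circ> ?k) x" if \<phi>: "\<phi> \<in> auto ?Q" for \<phi>
    proof -
      \<comment> \<open>Conjugation by \<open>h\<close> turns \<open>\<phi>\<close> into an
        automorphism of \<open>P\<close>; it is restricted to the carrier because
        \<open>auto\<close> consists of extensional maps.\<close>
      let ?\<psi> = "\<lambda>g\<in>carrier P. ?k (\<phi> (h g))"
      have hom: "\<phi> \<in> hom ?Q ?Q" and bij: "bij_betw \<phi> (h ` carrier P) (h ` carrier P)"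
        using \<phi> by (auto simp: auto_def Bij_def)
      have k: "bij_betw ?k (h ` carrier P) (carrier P)"
        using inj by (simp add: inj_on_imp_bij_betw bij_betw_inv_into)
      have "bij_betw (?k \<circ> (\<phi> \<circ> h)) (carrier P) (carrier P)"
        using bij_betw_trans[OF bij_betw_trans[OF inj_on_imp_bij_betw[OF inj] bij] k] .
      then have b: "bij_betw ?\<psi> (carrier P) (carrier P)"
        by (subst bij_betw_restrict_eq) (simp add: comp_def)
      have "?\<psi> \<in> hom P P"
      proof (rule homI)
        show "?\<psi> g \<in> carrier P" if "g \<in> carrier P" for g using b that by (auto dest: bij_betwE)
        fix a b assume ab: "a \<in> carrier P" "b \<in> carrier P"
        then have c: "\<phi> (h a) \<in> h ` carrier P" "\<phi> (h b) \<in> h ` carrier P"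
          using bij by (auto dest: bij_betwE)
        have "\<phi> (h (a \<otimes>\<^bsub>P\<^esub> b)) = \<phi> (h a) \<otimes>\<^bsub>?Q\<^esub> \<phi> (h b)"
          using ab hom_mult[OF hom, of "h a" "h b"] by simp
        also have "\<dots> = h (?k (\<phi> (h a)) \<otimes>\<^bsub>P\<^esub> ?k (\<phi> (h b)))" by (rule mult)
        finally show "?\<psi> (a \<otimes>\<^bsub>P\<^esub> b) = ?\<psi> a \<otimes>\<^bsub>P\<^esub> ?\<psi> b"
          using ab c by (simp add: inv_into_into del: h.hom_mult)
      qed
      with b have "?\<psi> \<in> auto P" by (simp add: auto_def Bij_def)
      from P.lev_auto[OF this g(1)] g show ?thesis by simp
    qed
    fix A B assume A: "A \<in> J"
    show "\<exists>a\<in>carrier ?Q. \<exists>b\<in>carrier ?Q. (lev \<circ> ?k) a = A \<and> (lev \<circ> ?k) b = A \<and> x = a \<otimes>\<^bsub>?Q\<^esub> b"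
      if "(lev \<circ> ?k) x \<subseteq> A"
    proof -
      obtain a b where "a \<in> carrier P" "b \<in> carrier P" "lev a = A" "lev b = A" "g = a \<otimes>\<^bsub>P\<^esub> b"
        using P.lev_generic[OF g(1) A] \<open>(lev \<circ> ?k) x \<subseteq> A\<close> g by auto
      then show ?thesis using g by (intro bexI[of _ "h a"] bexI[of _ "h b"]) auto
    qed
    assume B: "B \<in> J" and AB: "(lev \<circ> ?k) x \<subseteq> A \<union> B"
    then obtain a b where "a \<in> carrier P" "b \<in> carrier P" "lev a \<subseteq> A" "lev b \<subseteq> B" "g = a \<otimes>\<^bsub>P\<^esub> b"
      using P.lev_split[OF g(1) A B] g by auto
    then show "\<exists>a\<in>carrier ?Q. \<exists>b\<in>carrier ?Q. (lev \<circ> ?k) a \<subseteq> A \<and> (lev \<circ> ?k) b \<subseteq> B \<and> x = a \<otimes>\<^bsub>?Q\<^esub> b"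
      using g by (intro bexI[of _ "h a"] bexI[of _ "h b"]) auto
  qed (simp_all add: P.J_Int P.J_Un)
qed

section \<open>Assembly of the construction\<close>

theorem theorem4p1:
  fixes G :: "('g, 'm) monoid_scheme" and p :: nat
  assumes "Factorial_Ring.prime p" and "odd p"
    and "group G" and "finite (carrier G)"
  shows "\<exists>(P :: nat monoid) (S :: (nat \<Rightarrow> 'f::field_char_0) set).
           comm_group P \<and> finite (carrier P) \<and> (\<exists>k. order P = p ^ k) \<and>
           rational_S_ring P S \<and> S_ring_Aut P S \<cong> G"
proof -
  interpret G: group G by fact
  obtain pos where pos: "bij_betw pos (carrier G) {..<card (carrier G)}"
    using ex_bij_betw_finite_nat[OF assms(4)] by (auto simp: atLeast0LessThan)
  let ?Y = "nodes G" and ?R = "node_le G pos"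
  interpret Y: finite_poset ?Y ?R using assms(4) by (rule finite_poset_nodes)
  \<comment> \<open>An arbitrary numbering of the poset makes the exponents of the cyclic factors
    distinct.\<close>
  obtain idx :: "'g node \<Rightarrow> nat" where "inj_on idx ?Y"
    using finite_imp_inj_to_nat_seg[OF Y.finite_Y] by blast
  then interpret Q: poset_group ?Y ?R p idx Bot Top
    using assms by unfold_locales (auto simp: node_le_Top)
  \<comment> \<open>The group elements are renamed by natural numbers, since \<open>P\<close> is to
    have type \<open>nat monoid\<close>.\<close>
  obtain h :: "_ \<Rightarrow> nat" where h: "inj_on h (carrier Q.Q)"
    using finite_imp_inj_to_nat_seg[OF Q.finite_Q] by blast
  let ?P = "image_group h Q.Q"
  interpret P: graded_group ?P "downsets ?Y ?R" "Q.level \<circ> inv_into (carrier Q.Q) h"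
    using graded_group_image_group[OF Q.graded_group_Q h] .
  have sub: "P.sub D = h ` Q.ideal_sub D" if D: "D \<in> downsets ?Y ?R" for D
  proof -
    have "P.sub D = h ` {x \<in> carrier Q.Q. Q.level x \<subseteq> D}"
      using h by (auto simp: P.sub_def image_group_carrier)
    also have "{x \<in> carrier Q.Q. Q.level x \<subseteq> D} = Q.ideal_sub D"
      using Q.level_subset_iff[OF _ D] by (auto simp: Q.ideal_sub_def)
    finally show ?thesis .
  qed
  have card_sub: "card (P.sub D) = card (Q.ideal_sub D)" if "D \<in> downsets ?Y ?R" for D
    unfolding sub[OF that] using h by (auto simp: Q.ideal_sub_def intro!: card_image inj_on_subset[OF h])
  have "order_Aut ?Y ?R \<cong> P.level_Aut"
  proof (rule P.order_Aut_iso_level_Aut[OF Y.finite_poset_axioms refl])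
    fix f D assume "f \<in> carrier (order_Aut ?Y ?R)" "D \<in> downsets ?Y ?R"
    then show "card (P.sub (f ` D)) = card (P.sub D)"
      using Y.image_downset Q.card_ideal_sub_image by (simp add: card_sub)
  qed
  from iso_trans[OF iso_trans[OF G.iso_order_Aut_nodes[OF assms(4) pos] this] P.level_Aut_iso_S_ring_Aut]
  have "G \<cong> S_ring_Aut ?P (P.lev_ring :: (nat \<Rightarrow> 'f) set)" .
  then have "S_ring_Aut ?P (P.lev_ring :: (nat \<Rightarrow> 'f) set) \<cong> G" by (rule G.iso_sym)
  moreover have "order ?P = p ^ (\<Sum>i\<in>?Y. Q.height i)"
    using Q.order_Q card_image[OF h] by (simp add: order_def image_group_carrier)
  ultimately show ?thesis
    using P.comm_group_axioms P.finite_P P.rational_lev_ring by blast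
qed

end
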